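(* Let $\lambda$ be a partition and let $q\ge1$ be a critical degree of $\mathcal R^{(\lambda)}$. Let $L^{(\lambda)}_q(x,y,\partial_x)=\pi^\flat(x,y,\partial_x)$ be the monic differential operator of order $q$ corresponding to $\pi(z)=z^q$. Then $$L^{(\lambda)}_q(x,y,\partial_x)\,R^{(\lambda)}_m(x,y)=\gamma^{(\lambda)}_q(m)\,R^{(\lambda)}_{m-q}(x,y),\qquad m\in\mathcal J^{(\lambda)}$$ (the right-hand side being $0$ when $m-q\notin\mathcal J^{(\lambda)}$, in which case $\gamma^{(\lambda)}_q(m)=0$). Moreover, $$L^{(\lambda)}_qf=\frac{\mathrm{Wr}[R^{(\lambda)}_{j_1},\dots,R^{(\lambda)}_{j_q},f]}{\mathrm{Wr}[R^{(\lambda)}_{j_1},\dots,R^{(\lambda)}_{j_q}]},$$ where $j_1,\dots,j_q$ is an enumeration of $\mathcal G^{(\lambda)}_q\subset\mathcal J^{(\lambda)}$ and $\mathrm{Wr}$ is the Wronskian in $x$.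
   Context: Partitions: $\lambda_1\ge\lambda_2\ge\cdots\ge0$ integers, $N=|\lambda|=\sum\lambda_i<\infty$, $\ell$ the number of nonzero entries, $m_i=\lambda_i-i$ ($i\ge1$), $\mathcal M^{(\lambda)}=\{m_i:i\ge1\}$, $\mathcal J^{(\lambda)}=\mathbb Z\setminus\mathcal M^{(\lambda)}$, $k_i=m_i+\ell$ for $1\le i\le\ell$. For $q\in\mathbb Z$: $\mathcal G^{(\lambda)}_q=(\mathcal M^{(\lambda)}+q)\cap\mathcal J^{(\lambda)}$ (a finite set) and $\gamma^{(\lambda)}_q(m)=\prod_{i\in\mathcal G^{(\lambda)}_q}(m-i)$. Bivariate Hermite polynomials: $e^{xz+yz^2}=\sum_{n\ge0}H_n(x,y)z^n/n!$. With $\mathrm{Wr}$ the Wronskian in $x$, $$R^{(\lambda)}_m=\frac{1}{\prod_{i=1}^{\ell}(m-m_i)}\,\frac{\mathrm{Wr}[H_{k_\ell},\dots,H_{k_1},H_{m+\ell}]}{\mathrm{Wr}[H_{k_\ell},\dots,H_{k_1}]}\ (m\in\mathcal J^{(\lambda)}),\qquad \Psi^{(\lambda)}(x,y,z)=\frac{\mathrm{Wr}[H_{k_\ell},\dots,H_{k_1},e^{xz+yz^2}]}{z^\ell\,\mathrm{Wr}[H_{k_\ell},\dots,H_{k_1}]}.$$ Let $W^{(\lambda)}=\mathrm{span}\{z^m:m\in\mathcal J^{(\lambda)}\}$ and $\mathcal R^{(\lambda)}=\{p\in\mathbb C[z]:pW^{(\lambda)}\subset W^{(\lambda)}\}$.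 An integer $q\ge0$ is a critical degree of $\mathcal R^{(\lambda)}$ if $z^q\in\mathcal R^{(\lambda)}$. (For such $q$, $\mathcal G^{(\lambda)}_q$ has exactly $q$ elements.) For $\pi\in\mathcal R^{(\lambda)}$, $\pi^\flat(x,y,\partial_x)$ is the unique differential operator in $x$ (with coefficients rational in $x,y$) such that $\pi^\flat(x,y,\partial_x)\Psi^{(\lambda)}(x,y,z)=\pi(z)\Psi^{(\lambda)}(x,y,z)$; for $\pi=z^q$ it is monic of order $q$. *)

theory Defs
  imports
    "HOL-Computational_Algebra.Formal_Laurent_Series"
    "HOL-Computational_Algebra.Polynomial_FPS"
    "HOL-Computational_Algebra.Polynomial_Factorial"
    "Jordan_Normal_Form.Determinant"
begin

section \<open>Partitions\<close>

text \<open>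
  A partition is a function \<open>lam\<close> whose entries are \<open>lam 1 \<ge> lam 2 \<ge> \<dots> \<ge> 0\<close>; the value \<open>lam 0\<close>
  is never used. Since the entries are natural numbers, their sum is finite iff only
  finitely many of them are nonzero.
\<close>

definition is_partition :: "(nat \<Rightarrow> nat) \<Rightarrow> bool" where
  "is_partition lam \<longleftrightarrow> (\<forall>i\<ge>1. lam (Suc i) \<le> lam i) \<and> finite {i. 1 \<le> i \<and> lam i \<noteq> 0}"

definition part_len :: "(nat \<Rightarrow> nat) \<Rightarrow> nat" where
  "part_len lam = card {i. 1 \<le> i \<and> lam i \<noteq> 0}"

definition part_m :: "(nat \<Rightarrow> nat) \<Rightarrow> nat \<Rightarrow> int" where
  "part_m lam i = int (lam i) - int i"

definition part_M :: "(nat \<Rightarrow> nat) \<Rightarrow> int set" where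
  "part_M lam = part_m lam ` {1..}"

definition part_J :: "(nat \<Rightarrow> nat) \<Rightarrow> int set" where
  "part_J lam = UNIV - part_M lam"

text \<open>For \<open>1 \<le> i \<le> part_len lam\<close> the integer below is nonnegative, so \<open>nat\<close> truncates nothing.\<close>

definition part_k :: "(nat \<Rightarrow> nat) \<Rightarrow> nat \<Rightarrow> nat" where
  "part_k lam i = nat (part_m lam i + int (part_len lam))"

definition part_G :: "(nat \<Rightarrow> nat) \<Rightarrow> int \<Rightarrow> int set" where
  "part_G lam q = (\<lambda>i. i + q) ` part_M lam \<inter> part_J lam"

definition part_gamma :: "(nat \<Rightarrow> nat) \<Rightarrow> int \<Rightarrow> int \<Rightarrow> int" where
  "part_gamma lam q m = (\<Prod>i\<in>part_G lam q. m - i)"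


section \<open>The differential field of rational functions in x and y\<close>

text \<open>
  The field \<open>\<complex>(x,y)\<close> is the fraction field of \<open>\<complex>[y][x]\<close>: the outer polynomial variable is \<open>x\<close>,
  the inner one is \<open>y\<close>, so \<open>\<partial>/\<partial>x\<close> is \<^const>\<open>pderiv\<close> on polynomials and the quotient rule on
  fractions.
\<close>

type_synonym ratfun = "complex poly poly fract"

instance fract :: ("{idom, ring_char_0}") field_char_0
proof
  show "inj (of_nat :: nat \<Rightarrow> 'a fract)"
    by (rule injI) (simp add: of_nat_fract eq_fract)
qed

definition ratX :: ratfun where
  "ratX = to_fract [:0, 1:]"

definition ratY :: ratfun where
  "ratY = to_fract [:[:0, 1:]:]"

definition ratC :: "complex \<Rightarrow> ratfun" where
  "ratC c = to_fract [:[:c:]:]"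

definition fract_pderiv :: "'a::idom poly fract \<Rightarrow> 'a poly fract" where
  "fract_pderiv f =
     (case SOME (a, b). b \<noteq> 0 \<and> f = Fract a b of
       (a, b) \<Rightarrow> Fract (pderiv a * b - a * pderiv b) (b * b))"

text \<open>The choice of numerator and denominator is immaterial:\<close>

lemma fract_pderiv_Fract:
  fixes a b :: "'a::idom poly"
  assumes b: "b \<noteq> 0"
  shows "fract_pderiv (Fract a b) = Fract (pderiv a * b - a * pderiv b) (b * b)"
proof -
  define r where "r = (SOME (c, d). d \<noteq> 0 \<and> Fract a b = Fract c d)"
  have "case r of (c, d) \<Rightarrow> d \<noteq> 0 \<and> Fract a b = Fract c d"
    unfolding r_def by (rule someI[of _ "(a, b)"]) (simp add: b)
  then obtain c d where r: "r = (c, d)" and d: "d \<noteq> 0" and e: "Fract a b = Fract c d"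
    by (cases r) auto
  have ad: "a * d = c * b"
    using e b d by (simp add: eq_fract)
  have d1: "pderiv a * d + a * pderiv d = pderiv c * b + c * pderiv b"
    using arg_cong[OF ad, of pderiv] by (simp add: pderiv_mult algebra_simps)
  have "(pderiv a * b - a * pderiv b) * (d * d) - (pderiv c * d - c * pderiv d) * (b * b)
      = b * d * (pderiv a * d + a * pderiv d - (pderiv c * b + c * pderiv b))
        - (a * d - c * b) * (pderiv b * d + b * pderiv d)"
    by (simp add: algebra_simps)
  also have "\<dots> = 0"
    using ad d1 by simp
  finally show ?thesis
    using b d by (simp add: fract_pderiv_def flip: r_def) (simp add: r eq_fract)
qed

abbreviation dx :: "ratfun \<Rightarrow> ratfun" where
  "dx \<equiv> fract_pderiv"

text \<open>
  \<open>\<partial>/\<partial>x\<close> on Laurent series in \<open>z\<close> with coefficients in \<open>\<complex>(x,y)\<close>.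
\<close>

definition dx_fls :: "ratfun fls \<Rightarrow> ratfun fls" where
  "dx_fls F = Abs_fls (\<lambda>n. dx (fls_nth F n))"


section \<open>Wronskians and differential operators\<close>

definition wronskian :: "('a::comm_ring_1 \<Rightarrow> 'a) \<Rightarrow> 'a list \<Rightarrow> 'a" where
  "wronskian D fs = det (mat (length fs) (length fs) (\<lambda>(i, j). (D ^^ i) (fs ! j)))"

text \<open>
  A differential operator \<open>\<Sum>\<^sub>j c\<^sub>j \<partial>\<^sub>x\<^sup>j\<close> with rational coefficients is given by the polynomial with
  coefficients \<open>c\<^sub>j\<close>, so its order is the \<^const>\<open>degree\<close>; multiplication of polynomials plays
  no role.  It acts on every commutative ring with a derivation \<open>D\<close> that contains
  \<open>(\<complex>(x,y), \<partial>\<^sub>x)\<close> through an embedding \<open>h\<close>: rational functions themselves, Laurent series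
  in \<open>z\<close> over them, germs of meromorphic functions, and so on.
\<close>

type_synonym diffop = "ratfun poly"

definition diffop_apply ::
  "(ratfun \<Rightarrow> 'a::comm_ring_1) \<Rightarrow> ('a \<Rightarrow> 'a) \<Rightarrow> diffop \<Rightarrow> 'a \<Rightarrow> 'a" where
  "diffop_apply h D L f = (\<Sum>j\<le>degree L. h (coeff L j) * (D ^^ j) f)"

definition diff_extension :: "(ratfun \<Rightarrow> 'a::comm_ring_1) \<Rightarrow> ('a \<Rightarrow> 'a) \<Rightarrow> bool" where
  "diff_extension h D \<longleftrightarrow>
     h 1 = 1 \<and> (\<forall>a b. h (a + b) = h a + h b) \<and> (\<forall>a b. h (a * b) = h a * h b) \<and>
     (\<forall>f g. D (f + g) = D f + D g) \<and> (\<forall>f g. D (f * g) = D f * g + f * D g) \<and>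
     (\<forall>a. D (h a) = h (dx a))"


section \<open>Hermite polynomials, R and Psi\<close>

text \<open>
  \<open>e\<^bsup>xz+yz\<^sup>2\<^esup>\<close> is identified with its expansion in powers of \<open>z\<close>.  As \<open>\<Psi>\<close> is this entire function
  times a Laurent polynomial in \<open>z\<close> over \<open>\<complex>(x,y)\<close>, the identity defining the operator
  attached to \<open>\<pi>\<close> may be read coefficientwise in \<open>z\<close>, that is in \<open>\<complex>(x,y)((z))\<close>.
\<close>

definition hermite_gf :: "ratfun fps" where
  "hermite_gf = fps_exp 1 oo (fps_const ratX * fps_X + fps_const ratY * fps_X ^ 2)"

definition hermite :: "nat \<Rightarrow> ratfun" where
  "hermite n = fact n * fps_nth hermite_gf n"

definition hermite_list :: "(nat \<Rightarrow> nat) \<Rightarrow> ratfun list" where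
  "hermite_list lam = map (\<lambda>i. hermite (part_k lam i)) (rev [1..<Suc (part_len lam)])"

text \<open>Meaningful only for \<open>m \<in> part_J lam\<close>; then \<open>m + part_len lam \<ge> 0\<close>.\<close>

definition R_fun :: "(nat \<Rightarrow> nat) \<Rightarrow> int \<Rightarrow> ratfun" where
  "R_fun lam m =
     1 / (\<Prod>i=1..part_len lam. of_int (m - part_m lam i)) *
     (wronskian dx (hermite_list lam @ [hermite (nat (m + int (part_len lam)))]) /
      wronskian dx (hermite_list lam))"

definition Psi_fun :: "(nat \<Rightarrow> nat) \<Rightarrow> ratfun fls" where
  "Psi_fun lam =
     wronskian dx_fls (map fls_const (hermite_list lam) @ [fps_to_fls hermite_gf]) /
     (fls_X ^ part_len lam * fls_const (wronskian dx (hermite_list lam)))"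


section \<open>The ring of eigenvalues and the operator attached to one of them\<close>

text \<open>\<open>W\<close> lives in the Laurent polynomials in \<open>z\<close>, regarded inside \<open>\<complex>((z))\<close>.\<close>

definition W_space :: "(nat \<Rightarrow> nat) \<Rightarrow> complex fls set" where
  "W_space lam = module.span (\<lambda>c f. fls_const c * f) (fls_X_intpow ` part_J lam)"

definition R_ring :: "(nat \<Rightarrow> nat) \<Rightarrow> complex poly set" where
  "R_ring lam = {p. \<forall>w\<in>W_space lam. fps_to_fls (fps_of_poly p) * w \<in> W_space lam}"

definition critical_degree :: "(nat \<Rightarrow> nat) \<Rightarrow> nat \<Rightarrow> bool" where
  "critical_degree lam q \<longleftrightarrow> monom 1 q \<in> R_ring lam"

definition flat :: "(nat \<Rightarrow> nat) \<Rightarrow> complex poly \<Rightarrow> diffop" where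
  "flat lam p = (THE L. diffop_apply fls_const dx_fls L (Psi_fun lam) =
                        fps_to_fls (fps_of_poly (map_poly ratC p)) * Psi_fun lam)"

definition L_op :: "(nat \<Rightarrow> nat) \<Rightarrow> nat \<Rightarrow> diffop" where
  "L_op lam q = flat lam (monom 1 q)"

end

theory Submission
  imports Defs
begin

text \<open>
  Write \<open>A f = Wr[H, f] / Wr[H]\<close> for the monic operator annihilating the Hermite polynomials
  \<open>H\<close> attached to the partition; up to constants and powers of \<open>z\<close>, \<open>R\<^sub>m\<close> is \<open>A H\<^bsub>m+l\<^esub>\<close>
  and \<open>\<Psi>\<close> is \<open>A e\<close> for \<open>e = exp (xz + yz\<^sup>2)\<close>. For a critical degree \<open>q\<close>, the Hermite
  polynomials of \<open>A\<close> together with those indexed by \<open>\<G>\<^sub>q\<close> are exactly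
  \<open>H\<^sub>0, \<dots>, H\<^bsub>q-1\<^esub>\<close> and the \<open>H\<^bsub>k+q\<^esub>\<close>, that is, a basis of the kernel of \<open>A \<partial>\<^sup>q\<close>.
  Since a monic operator is determined by the Wronskian of its kernel, factoring it in two
  ways gives \<open>L A = A \<partial>\<^sup>q\<close> with \<open>L f = Wr[R\<^bsub>j\<^esub>, f] / Wr[R\<^bsub>j\<^esub>]\<close>. Applied to \<open>e\<close> this is
  \<open>L \<Psi> = z\<^sup>q \<Psi>\<close>, and applied to \<open>H\<^bsub>m+l\<^esub>\<close> it is the lowering relation for \<open>R\<^sub>m\<close>.
\<close>

section \<open>Wronskian operators\<close>

lemma fract_pderiv_add: "fract_pderiv (f + g) = fract_pderiv f + fract_pderiv (g :: 'a::idom poly fract)"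
proof -
  obtain a b where f: "f = Fract a b" "b \<noteq> 0" by (cases f)
  obtain c d where g: "g = Fract c d" "d \<noteq> 0" by (cases g)
  show ?thesis using f g
    by (simp add: fract_pderiv_Fract eq_fract pderiv_mult pderiv_add algebra_simps)
qed

lemma fract_pderiv_mult:
  "fract_pderiv (f * g) = fract_pderiv f * g + f * fract_pderiv (g :: 'a::idom poly fract)"
proof -
  obtain a b where f: "f = Fract a b" "b \<noteq> 0" by (cases f)
  obtain c d where g: "g = Fract c d" "d \<noteq> 0" by (cases g)
  show ?thesis using f g
    by (simp add: fract_pderiv_Fract eq_fract pderiv_mult pderiv_add algebra_simps)
qed

lemma fract_pderiv_to_fract: "fract_pderiv (to_fract p) = to_fract (pderiv p)"
  by (simp add: to_fract_def fract_pderiv_Fract pderiv_1)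

text \<open>The product rule is assumed only for scalars from \<open>h\<close>: operators have no
  other products, and for Laurent series this rule can be checked coefficient by
  coefficient.\<close>

locale diff_embedding = comm_ring_hom h for h :: "ratfun \<Rightarrow> 'a::comm_ring_1" +
  fixes D :: "'a \<Rightarrow> 'a"
  assumes D_add: "D (f + g) = D f + D g"
    and D_h: "D (h a) = h (dx a)"
    and D_h_mult: "D (h a * f) = h (dx a) * f + h a * D f"
begin

lemma D_0: "D 0 = 0"
  using D_add[of 0 0] by simp

lemma D_sum: "D (sum f I) = (\<Sum>i\<in>I. D (f i))"
  by (induction I rule: infinite_finite_induct) (auto simp: D_0 D_add)

lemma D_pow_h: "(D ^^ n) (h a) = h ((dx ^^ n) a)"
  by (induction n) (auto simp: D_h)

lemma D_pow_const_mult: "dx c = 0 \<Longrightarrow> (D ^^ n) (h c * f) = h c * (D ^^ n) f"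
  by (induction n) (auto simp: D_h_mult hom_distribs)

text \<open>Padding with zero coefficients lets operators of different orders be compared over one
  index range.\<close>

lemma diffop_apply_bound:
  assumes "degree L \<le> n"
  shows "diffop_apply h D L f = (\<Sum>j\<le>n. h (coeff L j) * (D ^^ j) f)"
  unfolding diffop_apply_def
  by (rule sum.mono_neutral_left) (use assms in \<open>auto simp: coeff_eq_0\<close>)

lemma diffop_apply_diff:
  "diffop_apply h D (L - M) f = diffop_apply h D L f - diffop_apply h D M f"
proof -
  define n where "n = max (degree L) (degree M)"
  have "degree (L - M) \<le> n" "degree L \<le> n" "degree M \<le> n"
    by (auto simp: n_def intro: degree_diff_le_max)
  thus ?thesis
    by (simp add: diffop_apply_bound sum_subtractf hom_distribs algebra_simps)
qed

lemma diffop_apply_const_mult: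
  "dx c = 0 \<Longrightarrow> diffop_apply h D L (h c * f) = h c * diffop_apply h D L f"
  by (simp add: diffop_apply_def D_pow_const_mult sum_distrib_left mult.left_commute[of "h c"])

lemma diffop_apply_h: "diffop_apply h D L (h f) = h (diffop_apply id dx L f)"
  by (simp add: diffop_apply_def D_pow_h hom_distribs)

end

interpretation ratfun: diff_embedding id dx
proof unfold_locales
  show "dx (id a * f) = id (dx a) * f + id a * dx f" for a f
    by (simp add: fract_pderiv_mult)
qed (auto simp: fract_pderiv_add)

lemma dx_of_int: "dx (of_int c) = 0"
proof -
  \<comment> \<open>The product rule for \<open>1 * 1\<close> reads
    \<open>dx 1 = dx 1 + dx 1\<close>.\<close>
  have "dx 1 = 0" using fract_pderiv_mult[of 1 "1::ratfun"] by simp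
  hence "dx (of_nat n) = 0" for n
    by (induction n) (auto simp: fract_pderiv_add ratfun.D_0)
  moreover have "dx (- f) = - dx f" for f
    using fract_pderiv_add[of f "-f"] by (simp add: ratfun.D_0 eq_neg_iff_add_eq_0 add.commute)
  ultimately show ?thesis by (cases c) (auto simp flip: of_nat_Suc simp del: of_nat_Suc)
qed

lemma dx_divide_of_int: "dx (f / of_int c) = dx f / of_int c"
\<comment> \<open>For \<open>c = 0\<close> both sides are 0, since division by zero yields
  0.\<close>
proof (cases "of_int c = (0::ratfun)")
  case False
  have "dx (of_int c * (f / of_int c)) = of_int c * dx (f / of_int c)"
    by (simp only: fract_pderiv_mult dx_of_int mult_zero_left add_0)
  moreover have "of_int c * (f / of_int c) = f" using False by simp
  ultimately have "dx f = of_int c * dx (f / of_int c)" by (simp only:)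
  thus ?thesis using False by (metis nonzero_mult_div_cancel_left)
qed (auto simp: ratfun.D_0)

text \<open>The last column of the matrix is immaterial, since the cofactor deletes it.\<close>

definition last_cofactor :: "ratfun list \<Rightarrow> nat \<Rightarrow> ratfun" where
  "last_cofactor fs i =
     cofactor (mat (Suc (length fs)) (Suc (length fs)) (\<lambda>(r, c). (dx ^^ r) ((fs @ [0]) ! c)))
       i (length fs)"

text \<open>The coefficients come from expanding the numerator of \<open>Wr[fs, f] / Wr[fs]\<close>
  along the column of \<open>f\<close>.\<close>

definition wronski_op :: "ratfun list \<Rightarrow> diffop" where
  "wronski_op fs = (\<Sum>i\<le>length fs. monom (last_cofactor fs i / wronskian dx fs) i)"

lemma last_cofactor_length: "last_cofactor fs (length fs) = wronskian dx fs"
proof -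
  have "(-1 :: ratfun) ^ (length fs + length fs) = 1" by (simp flip: mult_2)
  moreover have "mat_delete (mat (Suc (length fs)) (Suc (length fs)) (\<lambda>(r, c). (dx ^^ r) ((fs @ [0]) ! c)))
      (length fs) (length fs) = mat (length fs) (length fs) (\<lambda>(i, j). (dx ^^ i) (fs ! j))"
    by (rule eq_matI) (auto simp: mat_delete_def nth_append)
  ultimately show ?thesis
    unfolding last_cofactor_def cofactor_def wronskian_def by simp
qed

lemma coeff_wronski_op:
  "coeff (wronski_op fs) i = (if i \<le> length fs then last_cofactor fs i / wronskian dx fs else 0)"
  by (simp add: wronski_op_def coeff_sum)

lemma monic_wronski_op:
  assumes "wronskian dx fs \<noteq> 0"
  shows "degree (wronski_op fs) = length fs" "coeff (wronski_op fs) (length fs) = 1"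
proof -
  show 1: "coeff (wronski_op fs) (length fs) = 1"
    using assms by (simp add: coeff_wronski_op last_cofactor_length)
  have "degree (wronski_op fs) \<le> length fs"
    by (rule degree_le) (simp add: coeff_wronski_op)
  thus "degree (wronski_op fs) = length fs"
    using 1 le_degree[of "wronski_op fs" "length fs"] by simp
qed

section \<open>Wronskians seen through an embedding\<close>

context diff_embedding
begin

lemma wronskian_h: "wronskian D (map h fs) = h (wronskian dx fs)"
proof -
  have "mat (length fs) (length fs) (\<lambda>(i, j). (D ^^ i) (map h fs ! j)) =
    map_mat h (mat (length fs) (length fs) (\<lambda>(i, j). (dx ^^ i) (fs ! j)))"
    by (rule eq_matI) (auto simp: D_pow_h)
  thus ?thesis by (simp add: wronskian_def)
qed

lemma wronskian_snoc:
  "wronskian D (map h fs @ [g]) = (\<Sum>i\<le>length fs. h (last_cofactor fs i) * (D ^^ i) g)"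
proof -
  define n where "n = length fs"
  define A where "A = mat (Suc n) (Suc n) (\<lambda>(r, c). (D ^^ r) ((map h fs @ [g]) ! c))"
  define B where "B = mat (Suc n) (Suc n) (\<lambda>(r, c). (dx ^^ r) ((fs @ [0]) ! c))"
  \<comment> \<open>Deleting column \<open>n\<close> removes the only column in which
    \<open>A\<close> is not the \<open>h\<close>-image of \<open>B\<close>.\<close>
  have cof: "cofactor A i n = h (cofactor B i n)" if "i \<le> n" for i
  proof -
    have "mat_delete A i n = map_mat h (mat_delete B i n)"
      by (rule eq_matI) (use that in \<open>auto simp: mat_delete_def A_def B_def nth_append n_def D_pow_h\<close>)
    moreover have "h ((-1) ^ k) = (-1) ^ k" for k
      by (induction k) (auto simp: hom_distribs)
    ultimately show ?thesis by (simp add: cofactor_def hom_distribs)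
  qed
  have "det A = (\<Sum>i<Suc n. A $$ (i, n) * cofactor A i n)"
    by (rule laplace_expansion_column) (auto simp: A_def)
  also have "\<dots> = (\<Sum>i\<le>n. h (last_cofactor fs i) * (D ^^ i) g)"
    unfolding lessThan_Suc_atMost
  proof (rule sum.cong)
    fix i assume "i \<in> {..n}"
    hence i: "i \<le> n" by simp
    have "A $$ (i, n) = (D ^^ i) g" using i by (simp add: A_def n_def nth_append)
    thus "A $$ (i, n) * cofactor A i n = h (last_cofactor fs i) * (D ^^ i) g"
      using cof[OF i] by (simp add: last_cofactor_def B_def n_def mult.commute)
  qed simp
  finally show ?thesis by (simp add: wronskian_def A_def n_def)
qed

lemma diffop_apply_wronski_op:
  assumes "wronskian dx fs \<noteq> 0"
  shows "diffop_apply h D (wronski_op fs) f =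
    h (1 / wronskian dx fs) * wronskian D (map h fs @ [f])"
proof -
  have "h (last_cofactor fs i / wronskian dx fs) =
      h (1 / wronskian dx fs) * h (last_cofactor fs i)" for i
    by (simp flip: hom_mult)
  thus ?thesis
    by (simp add: diffop_apply_bound[where n = "length fs"] monic_wronski_op[OF assms]
        coeff_wronski_op wronskian_snoc sum_distrib_left mult.assoc)
qed

end

section \<open>Monic operators are determined by their kernels\<close>

lemma diffop_apply_dx_wronski_op:
  "wronskian dx fs \<noteq> 0 \<Longrightarrow>
    diffop_apply id dx (wronski_op fs) f = wronskian dx (fs @ [f]) / wronskian dx fs"
  using ratfun.diffop_apply_wronski_op[of fs f] by simp

text \<open>The numerator Wronskian has two equal columns.\<close>

lemma wronski_op_annihilates:
  assumes "wronskian dx fs \<noteq> 0" "f \<in> set fs"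
  shows "diffop_apply id dx (wronski_op fs) f = 0"
proof -
  obtain k where k: "k < length fs" "f = fs ! k"
    using assms(2) by (auto simp: in_set_conv_nth)
  have "wronskian dx (fs @ [f]) = 0"
    unfolding wronskian_def
    by (rule det_identical_columns[where n = "Suc (length fs)" and i = k and j = "length fs"])
       (use k in \<open>auto simp: nth_append intro!: eq_vecI\<close>)
  thus ?thesis using assms(1) by (simp add: diffop_apply_dx_wronski_op)
qed

text \<open>The coefficient vector of \<open>B\<close> is killed by the transposed Wronskian matrix
  of \<open>fs\<close>, which is invertible.\<close>

lemma diffop_eq_0_if_annihilates:
  assumes W: "wronskian dx fs \<noteq> 0" and deg: "\<And>i. i \<ge> length fs \<Longrightarrow> coeff B i = 0"
    and B: "\<And>f. f \<in> set fs \<Longrightarrow> diffop_apply id dx B f = 0"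
  shows "B = 0"
proof -
  define n where "n = length fs"
  define M where "M = mat n n (\<lambda>(i, j). (dx ^^ i) (fs ! j))"
  have M: "M \<in> carrier_mat n n" by (simp add: M_def)
  define v where "v = vec n (coeff B)"
  have "transpose_mat M *\<^sub>v v = 0\<^sub>v n"
  proof (rule eq_vecI)
    fix j assume "j < dim_vec (0\<^sub>v n)"
    hence j: "j < n" by simp
    have "(transpose_mat M *\<^sub>v v) $ j = (\<Sum>i<n. (dx ^^ i) (fs ! j) * coeff B i)"
      using j by (simp add: M_def v_def scalar_prod_def lessThan_atLeast0)
    also have "\<dots> = (\<Sum>i\<le>n. coeff B i * (dx ^^ i) (fs ! j))"
      using deg by (simp add: n_def flip: lessThan_Suc_atMost) (simp add: mult.commute)
    also have "\<dots> = diffop_apply id dx B (fs ! j)"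
      using deg by (subst ratfun.diffop_apply_bound[where n = n]) (auto simp: n_def intro!: degree_le)
    also have "\<dots> = 0" using j by (intro B) (simp add: n_def)
    finally show "(transpose_mat M *\<^sub>v v) $ j = (0\<^sub>v n) $ j" using j by simp
  qed (simp add: M_def)
  moreover have "det (transpose_mat M) \<noteq> 0"
    using W unfolding det_transpose[OF M] by (simp add: wronskian_def M_def n_def)
  moreover have "v \<in> carrier_vec n" by (simp add: v_def)
  ultimately have v: "v = 0\<^sub>v n"
    using det_0_iff_vec_prod_zero[of "transpose_mat M" n] M by auto
  show "B = 0"
  proof (rule poly_eqI)
    fix i
    show "coeff B i = coeff 0 i"
      using deg[of i] arg_cong[OF v, of "\<lambda>u. vec_index u i"] by (cases "i < n") (auto simp: v_def n_def)
  qed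
qed

text \<open>Leading terms cancel in the difference of two monic operators of equal order, so the
  preceding lemma applies to it.\<close>

lemma eq_wronski_opI:
  assumes W: "wronskian dx fs \<noteq> 0" and "degree P = length fs" "lead_coeff P = 1"
    and "\<And>f. f \<in> set fs \<Longrightarrow> diffop_apply id dx P f = 0"
  shows "P = wronski_op fs"
proof -
  have "P - wronski_op fs = 0"
  proof (rule diffop_eq_0_if_annihilates[OF W])
    fix i assume "i \<ge> length fs"
    thus "coeff (P - wronski_op fs) i = 0"
      using assms(2,3) monic_wronski_op[OF W] by (cases "i = length fs") (auto simp: coeff_eq_0)
  qed (use assms in \<open>auto simp: ratfun.diffop_apply_diff wronski_op_annihilates\<close>)
  thus ?thesis by simp
qed

section \<open>Composition and factorisation of operators\<close>

context diff_embedding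
begin

text \<open>By the product rule, \<open>pCons 0 P\<close> collects the terms where \<open>D\<close>
  raises the derivative of \<open>f\<close>, and \<open>map_poly dx P\<close> those where it hits a
  coefficient.\<close>

lemma D_diffop_apply:
  "D (diffop_apply h D P f) = diffop_apply h D (pCons 0 P + map_poly dx P) f"
proof -
  define n where "n = degree P"
  have "degree (map_poly dx P) \<le> Suc n"
    by (rule degree_le) (simp add: n_def coeff_map_poly coeff_eq_0 ratfun.D_0)
  hence "degree (pCons 0 P + map_poly dx P) \<le> Suc n"
    using degree_pCons_le[of 0 P] by (intro degree_add_le) (simp_all add: n_def)
  hence "diffop_apply h D (pCons 0 P + map_poly dx P) f =
      (\<Sum>j\<le>Suc n. h (coeff (pCons 0 P) j) * (D ^^ j) f) + (\<Sum>j\<le>Suc n. h (dx (coeff P j)) * (D ^^ j) f)"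
    by (simp add: diffop_apply_bound coeff_map_poly ratfun.D_0 hom_distribs distrib_right
        sum.distrib del: sum.atMost_Suc)
  also have "(\<Sum>j\<le>Suc n. h (coeff (pCons 0 P) j) * (D ^^ j) f) =
      (\<Sum>j\<le>n. h (coeff P j) * (D ^^ Suc j) f)"
    by (subst sum.atMost_Suc_shift) simp
  also have "(\<Sum>j\<le>Suc n. h (dx (coeff P j)) * (D ^^ j) f) =
      (\<Sum>j\<le>n. h (dx (coeff P j)) * (D ^^ j) f)"
    by (simp add: n_def coeff_eq_0 ratfun.D_0)
  finally show ?thesis
    by (simp add: diffop_apply_def D_sum D_h_mult sum.distrib n_def add.commute)
qed

text \<open>Each further \<open>D\<close> raises the order by one through \<open>pCons 0 Q\<close>;
  the differentiated coefficients stay below the leading term.\<close>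

lemma D_pow_diffop_apply:
  assumes "degree P = n" "lead_coeff P = 1"
  obtains Q where "degree Q = n + i" "lead_coeff Q = 1"
    "\<And>f. (D ^^ i) (diffop_apply h D P f) = diffop_apply h D Q f"
proof (induction i arbitrary: thesis)
  case 0
  from 0[of P] assms show ?case by simp
next
  case (Suc i)
  obtain Q where Q: "degree Q = n + i" "lead_coeff Q = 1"
    "\<And>f. (D ^^ i) (diffop_apply h D P f) = diffop_apply h D Q f"
    using Suc.IH by blast
  have "degree (map_poly dx Q) \<le> n + i"
    by (rule degree_le) (use Q(1) in \<open>auto simp: coeff_map_poly coeff_eq_0 ratfun.D_0\<close>)
  moreover have "degree (pCons 0 Q) = Suc (n + i)"
    using Q by (subst degree_pCons_eq) auto
  ultimately have deg: "degree (pCons 0 Q + map_poly dx Q) = Suc (n + i)"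
    by (subst degree_add_eq_left) auto
  have "lead_coeff (pCons 0 Q + map_poly dx Q) = 1"
    unfolding deg using Q by (auto simp: coeff_map_poly coeff_eq_0 ratfun.D_0)
  with deg Q show ?case
    by (intro Suc.prems[of "pCons 0 Q + map_poly dx Q"]) (auto simp: D_diffop_apply)
qed

end

locale diff_embedding_idom = diff_embedding h D for h :: "ratfun \<Rightarrow> 'a::idom" and D
begin

text \<open>
  The powers of \<open>D\<close> composed with the monic operator of \<open>fs\<close> are again monic, so unitriangular
  row operations make the Wronskian matrix block triangular.
\<close>

lemma wronskian_append:
  assumes W: "wronskian dx fs \<noteq> 0"
  shows "wronskian D (map h fs @ gs) =
    h (wronskian dx fs) * wronskian D (map (diffop_apply h D (wronski_op fs)) gs)"
proof -
  define n r where "n = length fs" and "r = length gs"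
  define A where "A = diffop_apply h D (wronski_op fs)"
  define c where "c j = (map h fs @ gs) ! j" for j
  have "\<exists>Q. degree Q = n + i \<and> lead_coeff Q = 1 \<and> (\<forall>f. (D ^^ i) (A f) = diffop_apply h D Q f)" for i
  proof -
    obtain Q where "degree Q = n + i" "lead_coeff Q = 1"
      "\<And>f. (D ^^ i) (diffop_apply h D (wronski_op fs) f) = diffop_apply h D Q f"
      by (rule D_pow_diffop_apply[of "wronski_op fs" n i]) (use monic_wronski_op[OF W] in \<open>auto simp: n_def\<close>)
    thus ?thesis by (auto simp: A_def)
  qed
  then obtain Q where Q: "\<And>i. degree (Q i) = n + i" "\<And>i. lead_coeff (Q i) = 1"
    "\<And>i f. (D ^^ i) (A f) = diffop_apply h D (Q i) f" by metis
  define M where "M = mat (n + r) (n + r) (\<lambda>(i, j). (D ^^ i) (c j))"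
  \<comment> \<open>Row \<open>n + i\<close> of \<open>U\<close> lists the coefficients of
    \<open>Q i\<close>; as this has degree \<open>n + i\<close>, its leading coefficient 1 sits on
    the diagonal.\<close>
  define U where "U = mat (n + r) (n + r) (\<lambda>(i, k).
    if i < n then (if i = k then 1 else 0) else h (coeff (Q (i - n)) k))"
  have UM: "U \<in> carrier_mat (n + r) (n + r)" "M \<in> carrier_mat (n + r) (n + r)"
    by (auto simp: U_def M_def)
  have "det U = prod_list (diag_mat U)"
    by (rule det_lower_triangular[OF _ UM(1)]) (auto simp: U_def coeff_eq_0 Q(1))
  also have "\<dots> = 1"
    unfolding prod_list_diag_prod
  proof (rule prod.neutral, safe)
    fix i assume "i \<in> {0..<dim_row U}"
    hence "i < n + r" by (simp add: U_def)
    thus "U $$ (i, i) = 1"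
      using Q(2)[of "i - n"] by (auto simp: U_def Q(1))
  qed
  finally have det_U: "det U = 1" .
  have c_less: "c j = h (fs ! j)" if "j < n" for j
    using that by (simp add: c_def nth_append n_def)
  have c_ge: "c (n + j) = gs ! j" for j
    by (simp add: c_def nth_append n_def)
  have A_c: "(D ^^ i) (A (c j)) = 0" if "j < n" for i j
  proof -
    have "A (c j) = 0"
      using that wronski_op_annihilates[OF W, of "fs ! j"]
      by (simp add: c_less A_def diffop_apply_h n_def)
    moreover have "(D ^^ i) 0 = 0" by (induction i) (auto simp: D_0)
    ultimately show ?thesis by simp
  qed
  have A_h: "(D ^^ i) (A (h (fs ! j))) = 0" if "j < n" for i j
    using A_c[OF that] c_less[OF that] by simp
  \<comment> \<open>Multiplication by \<open>U\<close> keeps the first \<open>n\<close> rows and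
    turns row \<open>n + i\<close> into the \<open>i\<close>-th derivatives of
    \<open>A (c j)\<close>.\<close>
  have UM_entry: "(U * M) $$ (i, j) = (if i < n then (D ^^ i) (c j) else (D ^^ (i - n)) (A (c j)))"
    if ij: "i < n + r" "j < n + r" for i j
  proof -
    have "(U * M) $$ (i, j) = (\<Sum>k<n + r. U $$ (i, k) * (D ^^ k) (c j))"
      using ij UM by (simp add: M_def scalar_prod_def lessThan_atLeast0)
    also have "\<dots> = (if i < n then (D ^^ i) (c j) else (D ^^ (i - n)) (A (c j)))"
    proof (cases "i < n")
      case True
      have "(\<Sum>k<n + r. U $$ (i, k) * (D ^^ k) (c j)) = (\<Sum>k<n + r. if k = i then (D ^^ k) (c j) else 0)"
        by (rule sum.cong) (use True ij in \<open>auto simp: U_def\<close>)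
      thus ?thesis using True ij by simp
    next
      case False
      have "(\<Sum>k<n + r. U $$ (i, k) * (D ^^ k) (c j)) =
          (\<Sum>k<n + r. h (coeff (Q (i - n)) k) * (D ^^ k) (c j))"
        by (rule sum.cong) (use False ij in \<open>auto simp: U_def\<close>)
      also have "\<dots> = (\<Sum>k\<le>i. h (coeff (Q (i - n)) k) * (D ^^ k) (c j))"
        by (rule sum.mono_neutral_right) (use False ij in \<open>auto simp: coeff_eq_0 Q(1)\<close>)
      also have "\<dots> = diffop_apply h D (Q (i - n)) (c j)"
        by (rule diffop_apply_bound[symmetric]) (use False in \<open>simp add: Q(1)\<close>)
      finally show ?thesis using False by (simp add: Q(3))
    qed
    finally show ?thesis .
  qed
  \<comment> \<open>The lower left block vanishes because \<open>A\<close> annihilates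
    \<open>fs\<close>; the diagonal blocks are the two Wronskian matrices of the claim.\<close>
  define A1 A2 A4 where "A1 = mat n n (\<lambda>(i, j). (D ^^ i) (map h fs ! j))"
    and "A2 = mat n r (\<lambda>(i, j). (D ^^ i) (c (n + j)))"
    and "A4 = mat r r (\<lambda>(i, j). (D ^^ i) (map A gs ! j))"
  have "U * M = four_block_mat A1 A2 (0\<^sub>m r n) A4"
  proof (rule eq_matI)
    fix i j assume "i < dim_row (four_block_mat A1 A2 (0\<^sub>m r n) A4)"
      "j < dim_col (four_block_mat A1 A2 (0\<^sub>m r n) A4)"
    hence ij: "i < n + r" "j < n + r" by (auto simp: A1_def A4_def)
    show "(U * M) $$ (i, j) = four_block_mat A1 A2 (0\<^sub>m r n) A4 $$ (i, j)"
      using ij c_ge[of "j - n"] unfolding UM_entry[OF ij]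
      by (auto simp: A1_def A2_def A4_def A_h c_less n_def r_def)
  qed (use UM in \<open>auto simp: A1_def A4_def\<close>)
  hence "det (U * M) = det A1 * det A4"
    by (simp add: det_four_block_mat_lower_left_zero[where n = n and m = r] A1_def A2_def A4_def)
  moreover have "det (U * M) = det M"
    using det_mult[OF UM] det_U by simp
  moreover have "det A1 = h (wronskian dx fs)"
    using wronskian_h[of fs] by (simp add: wronskian_def A1_def n_def)
  ultimately show ?thesis
    by (simp add: wronskian_def M_def c_def A4_def A_def n_def r_def)
qed

end

interpretation ratfun: diff_embedding_idom id dx ..

lemma wronskian_dx_append:
  assumes "wronskian dx fs \<noteq> 0"
  shows "wronskian dx (fs @ gs) =
    wronskian dx fs * wronskian dx (map (diffop_apply id dx (wronski_op fs)) gs)"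
  using ratfun.wronskian_append[OF assms, of gs] by simp

text \<open>Numerator and denominator both split off the Wronskian of \<open>fs\<close>, which
  cancels. This is the factorisation of an operator by a part of its kernel.\<close>

lemma (in diff_embedding_idom) wronski_op_append:
  assumes "wronskian dx (fs @ gs) \<noteq> 0" and W: "wronskian dx fs \<noteq> 0"
  shows "diffop_apply h D (wronski_op (fs @ gs)) F =
    diffop_apply h D (wronski_op (map (diffop_apply id dx (wronski_op fs)) gs))
      (diffop_apply h D (wronski_op fs) F)"
proof -
  define As where "As = map (diffop_apply id dx (wronski_op fs)) gs"
  have split: "wronskian dx (fs @ gs) = wronskian dx fs * wronskian dx As"
    using wronskian_dx_append[OF W] by (simp add: As_def)
  hence "wronskian dx As \<noteq> 0" using assms by auto
  have "map h As = map (diffop_apply h D (wronski_op fs)) (map h gs)"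
    by (simp add: As_def diffop_apply_h)
  hence "wronskian D (map h (fs @ gs) @ [F]) =
    h (wronskian dx fs) * wronskian D (map h As @ [diffop_apply h D (wronski_op fs) F])"
    using wronskian_append[OF W, of "map h gs @ [F]"] by simp
  moreover have "h (1 / wronskian dx (fs @ gs)) * h (wronskian dx fs) = h (1 / wronskian dx As)"
    using W by (simp add: split flip: hom_mult)
  ultimately show ?thesis
    using assms \<open>wronskian dx As \<noteq> 0\<close>
    by (simp add: diffop_apply_wronski_op As_def[symmetric] flip: mult.assoc)
qed

section \<open>Hermite polynomials\<close>

lemma hermite_gf_nth_0: "fps_nth hermite_gf 0 = 1"
  by (simp add: hermite_gf_def)

lemma fps_deriv_hermite_gf:
  "fps_deriv hermite_gf = (fps_const ratX + 2 * fps_const ratY * fps_X) * hermite_gf"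
  unfolding hermite_gf_def
  by (subst fps_compose_deriv)
     (auto simp: power2_eq_square algebra_simps fps_compose_mult_distrib)

text \<open>The three-term recurrence of the Hermite polynomials, read off from the
  \<open>z\<close>-derivative of the generating function.\<close>

lemma hermite_gf_nth_Suc:
  "of_nat (Suc n) * fps_nth hermite_gf (Suc n) =
    ratX * fps_nth hermite_gf n + 2 * ratY * (if n = 0 then 0 else fps_nth hermite_gf (n - 1))"
proof -
  have "of_nat (Suc n) * fps_nth hermite_gf (Suc n) = fps_nth (fps_deriv hermite_gf) n"
    by simp
  also have "fps_deriv hermite_gf =
    fps_const ratX * hermite_gf + fps_const (2 * ratY) * (fps_X * hermite_gf)"
    unfolding fps_deriv_hermite_gf by (simp add: algebra_simps fps_const_mult[symmetric] numeral_fps_const del: fps_const_mult)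
  also have "fps_nth \<dots> n =
    ratX * fps_nth hermite_gf n + 2 * ratY * (if n = 0 then 0 else fps_nth hermite_gf (n - 1))"
    by simp
  finally show ?thesis .
qed

lemma dx_ratX: "dx ratX = 1" and dx_ratY: "dx ratY = 0"
  by (simp_all add: ratX_def ratY_def fract_pderiv_to_fract pderiv_pCons flip: one_pCons)

lemma dx_of_nat: "dx (of_nat n) = 0"
  using dx_of_int[of "int n"] by simp

lemma dx_numeral: "dx (numeral n) = 0"
  using dx_of_int[of "numeral n"] by simp

text \<open>In terms of the generating function, d/dx acts as multiplication by \<open>z\<close>.
  The induction differentiates the recurrence.\<close>

lemma dx_hermite_gf_nth:
  "dx (fps_nth hermite_gf n) = (if n = 0 then 0 else fps_nth hermite_gf (n - 1))"
proof (induction n rule: less_induct)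
  case (less n)
  show ?case
  proof (cases n)
    case 0
    thus ?thesis using dx_of_int[of 1] by (simp add: hermite_gf_nth_0)
  next
    case (Suc m)
    \<comment> \<open>Shifting the coefficients by one, with \<open>E 0 = 0\<close>, makes the
      recurrence uniform in \<open>k\<close>.\<close>
    define E where "E k = (if k = 0 then 0 else fps_nth hermite_gf (k - 1))" for k
    have E: "dx (E k) = E (k - 1)" if "k \<le> Suc m" for k
      using that less[of "k - 1"] Suc by (auto simp: E_def ratfun.D_0)
    have rec: "of_nat k * E (Suc k) = ratX * E k + 2 * ratY * E (k - 1)" for k
      using hermite_gf_nth_Suc[of "k - 1"]
      by (cases k) (auto simp: E_def)
    have "of_nat (Suc m) * dx (E (Suc (Suc m))) = dx (of_nat (Suc m) * E (Suc (Suc m)))"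
      by (simp only: fract_pderiv_mult dx_of_nat mult_zero_left add_0)
    also have "\<dots> = dx (ratX * E (Suc m) + 2 * ratY * E m)"
      by (simp only: rec diff_Suc_1)
    also have "\<dots> = E (Suc m) + (ratX * E m + 2 * ratY * E (m - 1))"
      by (simp add: fract_pderiv_add fract_pderiv_mult dx_ratX dx_ratY dx_numeral E)
    also have "ratX * E m + 2 * ratY * E (m - 1) = of_nat m * E (Suc m)"
      by (rule rec[symmetric])
    finally have "of_nat (Suc m) * dx (E (Suc (Suc m))) = of_nat (Suc m) * E (Suc m)"
      by (simp add: algebra_simps)
    hence "dx (E (Suc (Suc m))) = E (Suc m)"
      by (simp del: of_nat_Suc)
    thus ?thesis by (simp add: E_def Suc)
  qed
qed

lemma hermite_gf_nth: "fps_nth hermite_gf n = hermite n / fact n"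
  by (simp add: hermite_def)

lemma dx_hermite: "dx (hermite n) = of_nat n * hermite (n - 1)"
proof -
  have "dx (fact n) = (0 :: ratfun)"
    using dx_of_nat[of "fact n"] by simp
  thus ?thesis
    by (cases n) (auto simp: hermite_def fract_pderiv_mult dx_hermite_gf_nth ratfun.D_0)
qed

lemma dx_pow_hermite:
  "(dx ^^ i) (hermite n) = of_nat (\<Prod>j<i. n - j) * hermite (n - i)"
proof (induction i)
  case (Suc i)
  have "(dx ^^ Suc i) (hermite n) = dx (of_nat (\<Prod>j<i. n - j) * hermite (n - i))"
    by (simp only: Suc funpow.simps o_apply)
  also have "\<dots> = of_nat (\<Prod>j<i. n - j) * (of_nat (n - i) * hermite (n - i - 1))"
    by (simp only: fract_pderiv_mult dx_of_nat dx_hermite mult_zero_left add_0)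
  finally show ?case by (simp add: mult_ac)
qed simp

text \<open>
  At \<open>x = 1\<close>, \<open>y = 0\<close> every Hermite polynomial takes the value \<open>1\<close>, so the entries of the
  Wronskian matrix become falling factorials of the indices. A left kernel vector would then be
  a nonzero polynomial of degree less than the number of indices that vanishes at all of them.
\<close>

definition eval10 :: "complex poly poly \<Rightarrow> complex" where
  "eval10 p = poly (poly p 1) 0"

interpretation eval10: comm_ring_hom eval10
  by unfold_locales (auto simp: eval10_def)

text \<open>At \<open>x = 1\<close>, \<open>y = 0\<close> the generating function is the exponential
  series in \<open>z\<close>. The recurrence yields the polynomials, and its \<open>y\<close>-term
  vanishes at this point.\<close>

lemma hermite_poly: "\<exists>p. hermite n = to_fract p \<and> eval10 p = 1"
proof -
  have "\<exists>p. fps_nth hermite_gf n = to_fract p \<and> eval10 p = 1 / fact n"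
  proof (induction n rule: less_induct)
    case (less n)
    show ?case
    proof (cases n)
      case 0
      thus ?thesis by (intro exI[of _ 1]) (simp add: hermite_gf_nth_0)
    next
      case (Suc m)
      obtain p where p: "fps_nth hermite_gf m = to_fract p" "eval10 p = 1 / fact m"
        using less[of m] Suc by auto
      obtain p' where p': "(if m = 0 then 0 else fps_nth hermite_gf (m - 1)) = to_fract p'"
        using less[of "m - 1"] Suc by (cases m) (auto intro: that[of 0])
      \<comment> \<open>The recurrence gives \<open>Suc m\<close> times the next coefficient; the
        constant \<open>c\<close> carries out the division inside the polynomial ring.\<close>
      define c :: complex where "c = 1 / of_nat (Suc m)"
      define P where "P = [:[:c:]:] * ([:0, 1:] * p + 2 * [:[:0, 1:]:] * p')"
      have "to_fract [:[:c:]:] * of_nat (Suc m) = (1 :: ratfun)"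
      proof -
        have "[:[:c:]:] * of_nat (Suc m) = (1 :: complex poly poly)"
          unfolding of_nat_poly c_def by (simp add: of_nat_poly one_pCons del: of_nat_Suc)
        hence "to_fract ([:[:c:]:] * of_nat (Suc m)) = (1::ratfun)" by simp
        thus ?thesis by (simp add: to_fract_def of_nat_fract)
      qed
      hence "fps_nth hermite_gf n = to_fract [:[:c:]:] * (of_nat (Suc m) * fps_nth hermite_gf (Suc m))"
        by (simp only: Suc mult.assoc[symmetric] mult_1_left)
      also have "\<dots> = to_fract [:[:c:]:] * (ratX * to_fract p + 2 * ratY * to_fract p')"
        by (simp only: hermite_gf_nth_Suc p p')
      also have "\<dots> = to_fract P"
      proof -
        have "to_fract (2 :: complex poly poly) = 2"
          by (metis one_add_one to_fract_1 to_fract_add)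
        thus ?thesis by (simp only: P_def ratX_def ratY_def to_fract_mult to_fract_add)
      qed
      finally have "fps_nth hermite_gf n = to_fract P" .
      moreover have "eval10 P = 1 / fact n"
        by (simp add: P_def eval10_def c_def Suc p(2)[unfolded eval10_def] del: of_nat_Suc)
      ultimately show ?thesis by blast
    qed
  qed
  then obtain p where p: "fps_nth hermite_gf n = to_fract p" "eval10 p = 1 / fact n" by blast
  have to_fract_fact: "to_fract (of_nat (fact n)) = (fact n :: ratfun)"
    by (metis of_nat_fact of_nat_fract to_fract_def)
  have "hermite n = to_fract (of_nat (fact n) * p)"
    unfolding to_fract_mult by (simp add: hermite_def p to_fract_fact del: of_nat_fact)
  moreover have "eval10 (of_nat (fact n) * p) = 1"
    unfolding eval10.hom_mult eval10.hom_of_nat p by simp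
  ultimately show ?thesis by blast
qed

lemma wronskian_hermite_nonzero:
  assumes "distinct ns"
  shows "wronskian dx (map hermite ns) \<noteq> 0"
proof
  assume W: "wronskian dx (map hermite ns) = 0"
  define r where "r = length ns"
  \<comment> \<open>The falling factorial of \<open>n\<close> of length \<open>i\<close>; it has the
    factor \<open>n - n = 0\<close> when \<open>n < i\<close>.\<close>
  define a where "a i n = (\<Prod>j<i. n - j)" for i n :: nat
  have "\<exists>p. \<forall>n. hermite n = to_fract (p n) \<and> eval10 (p n) = 1"
    by (intro choice allI hermite_poly)
  then obtain p where p: "\<And>n. hermite n = to_fract (p n)" "\<And>n. eval10 (p n) = 1" by blast
  define M where "M = mat r r (\<lambda>(i, j). of_nat (a i (ns ! j)) * p (ns ! j - i))"
  define B where "B = (mat r r (\<lambda>(i, j). of_nat (a i (ns ! j))) :: complex mat)"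
  interpret fr: comm_ring_hom "to_fract :: complex poly poly \<Rightarrow> ratfun"
    by unfold_locales auto
  have D: "(dx ^^ i) (hermite n) = to_fract (of_nat (a i n) * p (n - i))" for i n
    by (simp only: dx_pow_hermite a_def p(1)[of "n - i"] fr.hom_mult fr.hom_of_nat)
  have "wronskian dx (map hermite ns) = det (map_mat to_fract M)"
    unfolding wronskian_def
    by (rule arg_cong[of _ _ det], rule eq_matI)
       (auto simp: M_def r_def D)
  hence "det M = 0" using W by (simp add: fr.hom_det)
  hence "det (map_mat eval10 M) = 0" by (simp add: eval10.hom_det)
  also have "map_mat eval10 M = B"
    by (rule eq_matI)
       (auto simp: M_def B_def eval10.hom_mult eval10.hom_of_nat p simp del: of_nat_prod)
  finally have "det B = 0" .
  hence "det (transpose_mat B) = 0"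
    by (subst det_transpose[of _ r]) (auto simp: B_def)
  then obtain v where v: "v \<in> carrier_vec r" "v \<noteq> 0\<^sub>v r" "transpose_mat B *\<^sub>v v = 0\<^sub>v r"
    using det_0_iff_vec_prod_zero[of "transpose_mat B" r] by (auto simp: B_def)
  define ff where "ff i = (\<Prod>j<i. [:- of_nat j, 1 :: complex:])" for i :: nat
  have deg_ff: "degree (ff i) = i" for i
    unfolding ff_def by (subst degree_prod_eq_sum_degree) auto
  have poly_ff: "poly (ff i) (of_nat n) = of_nat (a i n)" for i n
  proof (cases "i \<le> n")
    case True
    thus ?thesis by (auto simp: ff_def a_def poly_prod of_nat_diff intro!: prod.cong)
  next
    case False
    hence n: "n \<in> {..<i}" by auto
    have "poly (ff i) (of_nat n) = 0"
      unfolding ff_def poly_prod by (rule prod_zero) (use n in \<open>auto intro!: bexI[of _ n]\<close>)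
    moreover have "a i n = 0"
      unfolding a_def by (rule prod_zero) (use n in \<open>auto intro!: bexI[of _ n]\<close>)
    ultimately show ?thesis by simp
  qed
  \<comment> \<open>The kernel vector \<open>v\<close> becomes a combination of falling factorial
    polynomials, and each entry of the kernel equation says that one index is a root.\<close>
  define P where "P = (\<Sum>i<r. Polynomial.smult (v $ i) (ff i))"
  have root: "poly P (of_nat n) = 0" if n: "n \<in> set ns" for n
  proof -
    obtain j where j: "j < r" "n = ns ! j"
      using n by (metis in_set_conv_nth r_def)
    have "0 = (transpose_mat B *\<^sub>v v) $ j" using v j by simp
    also have "\<dots> = (\<Sum>i<r. of_nat (a i n) * v $ i)"
      using j v(1) by (simp add: B_def scalar_prod_def lessThan_atLeast0)
    also have "\<dots> = poly P (of_nat n)"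
      by (simp add: P_def poly_sum poly_ff mult.commute)
    finally show ?thesis by simp
  qed
  have "P = 0"
  proof (rule ccontr)
    assume nz: "P \<noteq> 0"
    have "r > 0" using nz by (cases r) (auto simp: P_def)
    have "r = card (of_nat ` set ns :: complex set)"
      using assms by (simp add: card_image inj_on_def distinct_card r_def)
    also have "\<dots> \<le> card {x. poly P x = 0}"
      by (rule card_mono) (use root nz in \<open>auto simp: poly_roots_finite\<close>)
    also have "\<dots> \<le> degree P" using nz by (rule card_poly_roots_bound)
    also have "\<dots> \<le> r - 1"
      unfolding P_def by (rule degree_sum_le) (auto simp: deg_ff intro: order.trans[OF degree_smult_le])
    finally show False using \<open>r > 0\<close> by simp
  qed
  \<comment> \<open>\<open>ff i\<close> is monic of degree \<open>i\<close>, so the coefficients of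
    \<open>P = 0\<close> give the entries of \<open>v\<close> one after another, from the highest
    index down.\<close>
  have "v $ i = 0" if "i < r" for i
    using that
  proof (induction "r - i" arbitrary: i rule: less_induct)
    case (less i)
    have "0 = coeff P i" using \<open>P = 0\<close> by simp
    also have "\<dots> = (\<Sum>k<r. v $ k * coeff (ff k) i)"
      by (simp add: P_def coeff_sum)
    also have "\<dots> = (\<Sum>k<r. if k = i then v $ i * coeff (ff i) i else 0)"
    proof (rule sum.cong)
      fix k assume "k \<in> {..<r}"
      thus "v $ k * coeff (ff k) i = (if k = i then v $ i * coeff (ff i) i else 0)"
        using less.hyps[of k] less.prems deg_ff[of k] by (cases k i rule: linorder_cases) (auto simp: coeff_eq_0)
    qed simp
    also have "\<dots> = v $ i * lead_coeff (ff i)" using less.prems by (simp add: deg_ff)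
    also have "lead_coeff (ff i) = 1" by (simp add: ff_def lead_coeff_prod)
    finally show ?case by simp
  qed
  hence "v = 0\<^sub>v r" using v(1) by (intro eq_vecI) auto
  with v(2) show False by contradiction
qed

text \<open>Constants scale the columns, which is multiplication on the right by a diagonal
  matrix.\<close>

lemma wronskian_const_mult:
  assumes "\<And>n. n \<in> set ns \<Longrightarrow> dx (c n) = 0"
  shows "wronskian dx (map (\<lambda>n. c n * g n) ns) = (\<Prod>n\<leftarrow>ns. c n) * wronskian dx (map g ns)"
proof -
  define r where "r = length ns"
  define M where "M = mat r r (\<lambda>(i, j). (dx ^^ i) (map g ns ! j))"
  define C where "C = mat r r (\<lambda>(i, j). if i = j then c (ns ! j) else 0)"
  have MC: "M \<in> carrier_mat r r" "C \<in> carrier_mat r r" by (auto simp: M_def C_def)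
  have "mat r r (\<lambda>(i, j). (dx ^^ i) (map (\<lambda>n. c n * g n) ns ! j)) = M * C"
  proof (rule eq_matI)
    fix i j assume "i < dim_row (M * C)" "j < dim_col (M * C)"
    hence ij: "i < r" "j < r" by (auto simp: M_def C_def)
    have "(M * C) $$ (i, j) = (\<Sum>k<r. M $$ (i, k) * C $$ (k, j))"
      using ij MC by (simp add: scalar_prod_def lessThan_atLeast0)
    also have "\<dots> = (\<Sum>k<r. if k = j then (dx ^^ i) (g (ns ! j)) * c (ns ! j) else 0)"
      by (rule sum.cong) (use ij in \<open>auto simp: M_def C_def r_def\<close>)
    also have "\<dots> = (dx ^^ i) (c (ns ! j) * g (ns ! j))"
      using ij ratfun.D_pow_const_mult[of "c (ns ! j)" i "g (ns ! j)"] assms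
      by (simp add: r_def)
    finally show "mat r r (\<lambda>(i, j). (dx ^^ i) (map (\<lambda>n. c n * g n) ns ! j)) $$ (i, j) = (M * C) $$ (i, j)"
      using ij by (simp add: r_def)
  qed (auto simp: M_def C_def)
  moreover have "det C = (\<Prod>n\<leftarrow>ns. c n)"
  proof -
    have "det C = prod_list (diag_mat C)"
      by (rule det_upper_triangular[OF _ MC(2)]) (auto simp: C_def)
    also have "diag_mat C = map c ns"
      by (rule nth_equalityI) (auto simp: diag_mat_def C_def r_def)
    finally show ?thesis .
  qed
  ultimately show ?thesis
    using det_mult[OF MC] by (simp add: wronskian_def r_def M_def)
qed

section \<open>Laurent series in \<open>z\<close> over the rational functions\<close>

lemma dx_fls_nth: "fls_nth (dx_fls F) n = dx (fls_nth F n)"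
  unfolding dx_fls_def
  \<comment> \<open>Since \<open>dx 0 = 0\<close>, differentiation preserves the lower bound on the
    exponents.\<close>
  by (rule nth_Abs_fls_lower_bound[of "fls_subdegree F"]) (simp add: ratfun.D_0)

interpretation fls: diff_embedding_idom fls_const dx_fls
  by unfold_locales
     (auto intro!: fls_eqI simp: dx_fls_nth fract_pderiv_add fract_pderiv_mult ratfun.D_0
       fls_plus_const fls_const_mult_const)

lemma dx_fls_pow_nth: "fls_nth ((dx_fls ^^ i) F) n = (dx ^^ i) (fls_nth F n)"
  by (induction i arbitrary: n) (auto simp: dx_fls_nth)

lemma diffop_apply_fls_nth:
  "fls_nth (diffop_apply fls_const dx_fls L F) n = diffop_apply id dx L (fls_nth F n)"
proof -
  have "fls_nth (sum f A) n = (\<Sum>i\<in>A. fls_nth (f i) n)" for f :: "nat \<Rightarrow> ratfun fls" and A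
    by (induction A rule: infinite_finite_induct) auto
  thus ?thesis by (simp add: diffop_apply_def dx_fls_pow_nth)
qed

lemma diffop_apply_fls_X_intpow_mult:
  "diffop_apply fls_const dx_fls L (fls_X_intpow k * F) =
    fls_X_intpow k * diffop_apply fls_const dx_fls L F"
  by (rule fls_eqI) (simp add: diffop_apply_fls_nth fls_X_intpow_times_conv_shift)

text \<open>The generating function is an eigenfunction of d/dx with eigenvalue
  \<open>z\<close>.\<close>

lemma dx_fls_pow_hermite_gf:
  "(dx_fls ^^ q) (fps_to_fls hermite_gf) = fls_X_intpow (int q) * fps_to_fls hermite_gf"
proof (induction q)
  case (Suc q)
  have "dx_fls (fls_X_intpow (int q) * fps_to_fls hermite_gf) =
      fls_X_intpow (int (Suc q)) * fps_to_fls hermite_gf"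
    unfolding fls_X_intpow_times_conv_shift
    by (rule fls_eqI)
       (auto simp: dx_fls_nth dx_hermite_gf_nth ratfun.D_0
          nat_diff_distrib intro!: arg_cong[of _ _ "fps_nth hermite_gf"])
  with Suc show ?case by simp
qed simp

lemma diff_embedding_if_diff_extension:
  assumes "diff_extension h D"
  shows "diff_embedding h D"
proof
  show "h 0 = 0"
    using assms unfolding diff_extension_def by (metis add_cancel_right_left)
qed (use assms in \<open>auto simp: diff_extension_def\<close>)

lemma (in diff_embedding) diffop_apply_monom:
  "diffop_apply h D (monom 1 q) F = (D ^^ q) F"
proof -
  have "diffop_apply h D (monom 1 q) F = (\<Sum>j\<le>q. if j = q then (D ^^ q) F else 0)"
    unfolding diffop_apply_def by (rule sum.cong) (auto simp: degree_monom_eq)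
  thus ?thesis by simp
qed

text \<open>The operator depends only on the set of indices, because this set fixes both the order
  and the annihilated functions.\<close>

lemma wronski_op_hermite_cong:
  assumes "distinct ns" "distinct ns'" "set ns = set ns'"
  shows "wronski_op (map hermite ns) = wronski_op (map hermite ns')"
proof (rule eq_wronski_opI)
  have "length ns = length ns'"
    using assms by (metis distinct_card)
  thus "degree (wronski_op (map hermite ns)) = length (map hermite ns')"
    using assms by (simp add: monic_wronski_op wronskian_hermite_nonzero)
  show "lead_coeff (wronski_op (map hermite ns)) = 1"
    using monic_wronski_op[OF wronskian_hermite_nonzero[OF assms(1)]] by simp
qed (use assms in \<open>auto simp: wronskian_hermite_nonzero wronski_op_annihilates\<close>)

lemma dx_pow_hermite_less: "n < q \<Longrightarrow> (dx ^^ q) (hermite n) = 0"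
  by (auto simp: dx_pow_hermite intro!: bexI[of _ n])

lemma wronski_op_hermite_upt: "wronski_op (map hermite [0..<q]) = monom 1 q"
  by (rule eq_wronski_opI[symmetric])
     (auto simp: wronskian_hermite_nonzero degree_monom_eq ratfun.diffop_apply_monom dx_pow_hermite_less)

lemma dx_pow_hermite_add: "(dx ^^ q) (hermite (k + q)) = of_nat (\<Prod>j<q. k + q - j) * hermite k"
  by (simp add: dx_pow_hermite)

text \<open>The first \<open>q\<close> Hermite polynomials split off the factor
  \<open>D ^^ q\<close>, which lowers the remaining ones to nonzero multiples of those indexed by
  \<open>ks\<close>.\<close>

lemma (in diff_embedding_idom) wronski_op_hermite_shift:
  assumes "distinct ks"
  shows "diffop_apply h D (wronski_op (map hermite ([0..<q] @ map (\<lambda>k. k + q) ks))) F =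
    diffop_apply h D (wronski_op (map hermite ks)) ((D ^^ q) F)"
proof -
  define hs where "hs = map hermite (map (\<lambda>k. k + q) ks)"
  have "distinct ([0..<q] @ map (\<lambda>k. k + q) ks)"
    using assms by (auto simp: distinct_map inj_on_def)
  hence W: "wronskian dx (map hermite [0..<q] @ hs) \<noteq> 0" "wronskian dx (map hermite [0..<q]) \<noteq> 0"
    using wronskian_hermite_nonzero[of "[0..<q] @ map (\<lambda>k. k + q) ks"]
      wronskian_hermite_nonzero[of "[0..<q]"] by (simp_all add: hs_def)
  have op: "diffop_apply id dx (monom 1 q) = dx ^^ q"
    by (rule ext) (rule ratfun.diffop_apply_monom)
  have "wronski_op (map hermite ks) = wronski_op (map (dx ^^ q) hs)"
  proof (rule eq_wronski_opI)
    show "wronskian dx (map (dx ^^ q) hs) \<noteq> 0"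
      using W wronskian_dx_append[OF W(2), of hs] by (auto simp: op wronski_op_hermite_upt)
    show "degree (wronski_op (map hermite ks)) = length (map (dx ^^ q) hs)"
      using assms by (simp add: hs_def monic_wronski_op wronskian_hermite_nonzero)
    show "lead_coeff (wronski_op (map hermite ks)) = 1"
      using monic_wronski_op[OF wronskian_hermite_nonzero[OF assms]] by simp
    fix f assume "f \<in> set (map (dx ^^ q) hs)"
    then obtain k where k: "k \<in> set ks" "f = (dx ^^ q) (hermite (k + q))"
      by (auto simp: hs_def)
    show "diffop_apply id dx (wronski_op (map hermite ks)) f = 0"
      using ratfun.diffop_apply_const_mult[OF dx_of_nat, of "wronski_op (map hermite ks)"] k assms
      by (simp add: dx_pow_hermite_add wronskian_hermite_nonzero wronski_op_annihilates
          del: of_nat_prod)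
  qed
  thus ?thesis
    using wronski_op_append[OF W, of F]
    by (simp add: op wronski_op_hermite_upt diffop_apply_monom hs_def)
qed

section \<open>Partitions\<close>

text \<open>Applied to the positions of nonzero entries, this turns the cardinality
  \<open>part_len\<close> into the last such position.\<close>

lemma down_closed_eq_atLeastAtMost_card:
  assumes "finite S" "0 \<notin> S" and "\<And>i. Suc i \<in> S \<Longrightarrow> i \<ge> 1 \<Longrightarrow> i \<in> S"
  shows "S = {1..card S}"
proof (cases "S = {}")
  case False
  have S: "S = {1..Max S}"
  proof (intro equalityI subsetI)
    fix i assume "i \<in> S"
    moreover have "i \<noteq> 0" using \<open>i \<in> S\<close> assms(2) by metis
    ultimately show "i \<in> {1..Max S}" using assms(1) by simp
  next
    fix i assume "i \<in> {1..Max S}"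
    hence "i \<le> Max S" "i \<ge> 1" by auto
    thus "i \<in> S"
    proof (induction rule: inc_induct)
      case base
      show ?case using assms(1) False by simp
    next
      case (step n)
      thus ?case using assms(3)[of n] \<open>i \<ge> 1\<close> by simp
    qed
  qed
  from arg_cong[OF S, of card] have "card S = Max S" by simp
  with S show ?thesis by simp
qed auto

locale partition =
  fixes lam :: "nat \<Rightarrow> nat"
  assumes partition: "is_partition lam"
begin

definition l :: nat where "l = part_len lam"

text \<open>
  From here on indices are shifted by \<open>l\<close>: the natural number \<open>n\<close> stands for the integer
  \<open>int n - int l\<close>, and \<open>ks\<close> for the part of \<open>part_M lam\<close> that is at least \<open>- int l\<close>.
\<close>

definition ks :: "nat list" where "ks = map (part_k lam) (rev [1..<Suc l])"

lemma lam_Suc_le: "i \<ge> 1 \<Longrightarrow> lam (Suc i) \<le> lam i"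
  and finite_nonzero: "finite {i. 1 \<le> i \<and> lam i \<noteq> 0}"
  using partition unfolding is_partition_def by blast+

lemma nonzero_iff:
  assumes "i \<ge> 1"
  shows "lam i \<noteq> 0 \<longleftrightarrow> i \<le> l"
proof -
  have "{i. 1 \<le> i \<and> lam i \<noteq> 0} = {1..l}"
    unfolding l_def part_len_def
  proof (rule down_closed_eq_atLeastAtMost_card[OF finite_nonzero])
    fix i assume "Suc i \<in> {i. 1 \<le> i \<and> lam i \<noteq> 0}" "i \<ge> 1"
    thus "i \<in> {i. 1 \<le> i \<and> lam i \<noteq> 0}" using lam_Suc_le[of i] by simp
  qed simp
  hence "i \<in> {i. 1 \<le> i \<and> lam i \<noteq> 0} \<longleftrightarrow> i \<in> {1..l}" by (simp only:)
  thus ?thesis using assms by simp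
qed

lemma part_m_less: "1 \<le> i \<Longrightarrow> i < j \<Longrightarrow> part_m lam j < part_m lam i"
proof -
  assume "1 \<le> i" "i < j"
  have "lam j \<le> lam i" using \<open>i < j\<close> \<open>1 \<le> i\<close>
  proof (induction j rule: less_induct)
    case (less j)
    then obtain j' where "j = Suc j'" "i \<le> j'" by (cases j) auto
    moreover from this have "lam (Suc j') \<le> lam j'"
      using lam_Suc_le[of j'] \<open>1 \<le> i\<close> by simp
    ultimately show ?case
      using less.IH[of j'] \<open>1 \<le> i\<close> by (cases "i = j'") auto
  qed
  thus ?thesis using \<open>i < j\<close> by (simp add: part_m_def)
qed

lemma part_k: "1 \<le> i \<Longrightarrow> i \<le> l \<Longrightarrow> int (part_k lam i) = part_m lam i + int l"
  using nonzero_iff[of i] by (auto simp: part_k_def part_m_def l_def)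

lemma set_ks: "set ks = part_k lam ` {1..l}"
  by (auto simp: ks_def)

lemma inj_on_part_k: "inj_on (part_k lam) {1..l}"
proof (rule linorder_inj_onI')
  fix i j assume "i \<in> {1..l}" "j \<in> {1..l}" "i < j"
  thus "part_k lam i \<noteq> part_k lam j"
    using part_m_less[of i j] part_k[of i] part_k[of j] by auto
qed

lemma distinct_ks: "distinct ks"
proof -
  show ?thesis using inj_on_part_k
    by (simp add: ks_def distinct_map atLeastLessThanSuc_atLeastAtMost del: upt_Suc)
qed

lemma hermite_list_eq: "hermite_list lam = map hermite ks"
  by (simp add: hermite_list_def ks_def l_def)

text \<open>Entries beyond position \<open>l\<close> are zero, so the numbers
  \<open>part_m lam i = - int i\<close> fill up everything below \<open>- int l\<close>.\<close>

lemma less_mem_part_M: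
  assumes "m < - int l"
  shows "m \<in> part_M lam"
proof -
  define i where "i = nat (- m)"
  have i: "m = - int i" "i > l" using assms by (auto simp: i_def)
  hence "lam i = 0" using nonzero_iff[of i] by auto
  thus ?thesis using i by (auto simp: part_M_def part_m_def intro!: image_eqI[of _ _ i])
qed

lemma mem_part_M_iff: "int n - int l \<in> part_M lam \<longleftrightarrow> n \<in> set ks"
proof
  assume "int n - int l \<in> part_M lam"
  then obtain i where i: "i \<ge> 1" "int n - int l = part_m lam i" by (auto simp: part_M_def)
  have "i \<le> l"
    using nonzero_iff[OF i(1)] i(2) by (cases "i \<le> l") (auto simp: part_m_def)
  thus "n \<in> set ks" using i part_k[of i] by (auto simp: set_ks image_iff intro!: bexI[of _ i])
next
  assume "n \<in> set ks"
  then obtain i where "1 \<le> i" "i \<le> l" "n = part_k lam i" by (auto simp: set_ks)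
  thus "int n - int l \<in> part_M lam" using part_k[of i] by (auto simp: part_M_def)
qed

lemma mem_part_J_iff: "m \<in> part_J lam \<longleftrightarrow> (\<exists>n. m = int n - int l \<and> n \<notin> set ks)"
proof (cases "m < - int l")
  case True
  thus ?thesis using less_mem_part_M[of m] by (auto simp: part_J_def)
next
  case False
  hence "m = int (nat (m + int l)) - int l" by simp
  then obtain n where "m = int n - int l" by blast
  thus ?thesis by (auto simp: part_J_def mem_part_M_iff)
qed

lemma prod_part_m: "(\<Prod>i = 1..l. int n - int l - part_m lam i) = (\<Prod>k\<in>set ks. int n - int k)"
  unfolding set_ks prod.reindex[OF inj_on_part_k]
  by (rule prod.cong) (auto simp: part_k)

section \<open>The operator \<open>A\<close> and its relation to \<open>R_fun\<close> and
  \<open>Psi_fun\<close>\<close>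

definition A :: diffop where "A = wronski_op (hermite_list lam)"

lemma wronskian_hermite_list: "wronskian dx (hermite_list lam) \<noteq> 0"
  by (simp add: hermite_list_eq wronskian_hermite_nonzero distinct_ks)

text \<open>The normalising factor of \<open>R_fun\<close>. It is constant in \<open>x\<close> and
  so passes through every operator; the form \<open>of_int 1\<close> lets \<open>dx_of_int\<close>
  apply to the numerator.\<close>

definition R_coeff :: "nat \<Rightarrow> ratfun" where
  "R_coeff n = of_int 1 / of_int (\<Prod>k\<in>set ks. int n - int k)"

lemma dx_R_coeff: "dx (R_coeff n) = 0"
  unfolding R_coeff_def dx_divide_of_int dx_of_int by simp

lemma R_fun_eq:
  "R_fun lam (int n - int l) =
    R_coeff n * diffop_apply id dx A (hermite n)"
  unfolding R_fun_def l_def[symmetric] of_int_prod[symmetric] prod_part_m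
  by (simp add: R_coeff_def A_def diffop_apply_dx_wronski_op wronskian_hermite_list del: of_int_prod)

lemma A_hermite_ks: "k \<in> set ks \<Longrightarrow> diffop_apply id dx A (hermite k) = 0"
  using wronski_op_annihilates[OF wronskian_hermite_list, of "hermite k"]
  by (simp add: A_def hermite_list_eq)

lemma Psi_fun_eq:
  "Psi_fun lam = fls_X_intpow (- int l) * diffop_apply fls_const dx_fls A (fps_to_fls hermite_gf)"
proof -
  define w where "w = wronskian dx (hermite_list lam)"
  have "w \<noteq> 0" using wronskian_hermite_list by (simp add: w_def)
  \<comment> \<open>The denominator of \<open>Psi_fun\<close> is inverted explicitly, as a power of
    \<open>z\<close> times a constant series.\<close>
  have "(fls_X ^ l * fls_const w) * (fls_X_intpow (- int l) * fls_const (1 / w)) =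
    (fls_X ^ l * fls_X_intpow (- int l)) * (fls_const w * fls_const (1 / w))"
    by (simp only: mult_ac)
  also have "\<dots> = 1"
    using \<open>w \<noteq> 0\<close> by (simp add: fls_X_power_times_conv_shift)
  finally have "inverse (fls_X ^ l * fls_const w) = fls_X_intpow (- int l) * fls_const (1 / w)"
    by (rule inverse_unique)
  thus ?thesis
    unfolding Psi_fun_def A_def fls.diffop_apply_wronski_op[OF wronskian_hermite_list]
      l_def[symmetric] w_def[symmetric] divide_inverse[of _ "_ * _"]
    by (simp only: mult_ac)
qed

lemma Psi_fun_nth:
  "fls_nth (Psi_fun lam) (int n - int l) = diffop_apply id dx A (hermite n) / of_int (fact n)"
proof -
  have "fls_nth (Psi_fun lam) (int n - int l) =
      diffop_apply id dx A (1 / of_int (fact n) * hermite n)"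
    unfolding Psi_fun_eq fls_X_intpow_times_conv_shift
    by (simp add: diffop_apply_fls_nth hermite_gf_nth)
  also have "\<dots> = 1 / of_int (fact n) * diffop_apply id dx A (hermite n)"
    using ratfun.diffop_apply_const_mult[of "1 / of_int (fact n)" A "hermite n"]
    by (simp only: dx_divide_of_int dx_of_int[of 1, unfolded of_int_1] id_apply) simp
  finally show ?thesis by simp
qed

text \<open>Among the functions \<open>A H_n\<close> there are more than \<open>degree B\<close>
  with nonzero Wronskian: those with \<open>n\<close> beyond all of \<open>ks\<close>.\<close>

lemma diffop_eq_0_if_annihilates_A_hermite:
  assumes B: "\<And>n. diffop_apply id dx B (diffop_apply id dx A (hermite n)) = 0"
  shows "B = 0"
proof -
  \<comment> \<open>Inserting 0 keeps \<open>Max\<close> meaningful for the empty partition.\<close>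
  define N where "N = Suc (Max (insert 0 (set ks)))"
  define ns where "ns = [N..<N + Suc (degree B)]"
  have "k < N" if "k \<in> set ks" for k using that by (simp add: N_def le_imp_less_Suc)
  hence "distinct (ks @ ns)" using distinct_ks by (force simp: ns_def)
  hence "wronskian dx (hermite_list lam @ map hermite ns) \<noteq> 0"
    using wronskian_hermite_nonzero[of "ks @ ns"] by (simp add: hermite_list_eq)
  hence W: "wronskian dx (map (diffop_apply id dx A) (map hermite ns)) \<noteq> 0"
    unfolding wronskian_dx_append[OF wronskian_hermite_list] A_def by auto
  show ?thesis
    by (rule diffop_eq_0_if_annihilates[OF W]) (auto simp: B ns_def coeff_eq_0)
qed

text \<open>Provides the uniqueness behind the \<open>THE\<close> in \<open>flat\<close>: up to
  nonzero constants, the coefficients of \<open>Psi_fun lam\<close> are the functions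
  \<open>A H_n\<close>.\<close>

lemma diffop_eqI:
  assumes "diffop_apply fls_const dx_fls L (Psi_fun lam) = diffop_apply fls_const dx_fls L' (Psi_fun lam)"
  shows "L = L'"
proof -
  have "diffop_apply id dx (L - L') (diffop_apply id dx A (hermite n)) = 0" for n
  proof -
    have "0 = fls_nth (diffop_apply fls_const dx_fls (L - L') (Psi_fun lam)) (int n - int l)"
      using assms by (simp add: fls.diffop_apply_diff)
    also have "\<dots> = diffop_apply id dx (L - L') (diffop_apply id dx A (hermite n) / of_int (fact n))"
      by (simp only: diffop_apply_fls_nth Psi_fun_nth)
    finally have *: "diffop_apply id dx (L - L') (diffop_apply id dx A (hermite n) / of_int (fact n)) = 0" by simp
    show ?thesis
      using ratfun.diffop_apply_const_mult[OF dx_of_int[of "fact n"], of "L - L'"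
        "diffop_apply id dx A (hermite n) / of_int (fact n)"] * by simp
  qed
  hence "L - L' = 0" by (rule diffop_eq_0_if_annihilates_A_hermite)
  thus ?thesis by simp
qed

end

section \<open>Critical degrees and the set \<open>part_G\<close>\<close>

lemma module_fls_const: "Modules.module (\<lambda>c f. fls_const c * f :: complex fls)"
  by unfold_locales (auto simp: algebra_simps simp flip: fls_plus_const)

text \<open>Elements of \<open>W_space lam\<close> are supported on \<open>part_J lam\<close>, and
  multiplication by \<open>z^q\<close> moves the exponent of a monomial by \<open>q\<close>.\<close>

lemma (in partition) critical_degree_shift:
  assumes crit: "critical_degree lam q" and n: "n \<notin> set ks"
  shows "n + q \<notin> set ks"
proof -
  interpret Modules.module "\<lambda>c f. fls_const c * f :: complex fls" by (rule module_fls_const)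
  have supp: "fls_nth w m = 0" if "w \<in> W_space lam" "m \<notin> part_J lam" for w m
    using that(1) unfolding W_space_def
  proof (induction rule: span_induct_alt)
    case (step c x y)
    then obtain j where "x = fls_X_intpow j" "j \<in> part_J lam" by auto
    with step that(2) show ?case by auto
  qed simp
  define m where "m = int n - int l"
  have "m \<in> part_J lam" using n by (auto simp: m_def mem_part_J_iff)
  hence "fls_X_intpow m \<in> W_space lam" unfolding W_space_def by (intro span_base) auto
  hence "fps_to_fls (fps_of_poly (monom 1 q)) * fls_X_intpow m \<in> W_space lam"
    using crit by (auto simp: critical_degree_def R_ring_def)
  also have "fps_to_fls (fps_of_poly (monom 1 q)) = (fls_X ^ q :: complex fls)"
    by (simp add: fps_of_poly_monom' fps_to_fls_power)
  finally have "fls_X ^ q * fls_X_intpow m \<in> W_space lam" .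
  moreover have "fls_nth (fls_X ^ q * fls_X_intpow m :: complex fls) (m + int q) = 1"
    by (simp add: fls_X_power_times_conv_shift)
  ultimately have "m + int q \<in> part_J lam" using supp[of _ "m + int q"] by fastforce
  then obtain n' where "m + int q = int n' - int l" "n' \<notin> set ks" by (auto simp: mem_part_J_iff)
  moreover from this have "n' = n + q" by (simp add: m_def)
  ultimately show ?thesis by simp
qed

locale critical = partition lam for lam +
  fixes q :: nat
  assumes critical: "critical_degree lam q"
begin

text \<open>The shifted counterpart of \<open>(\<lambda>i. i + int q) ` part_M lam\<close>, cut off at \<open>- int l\<close>.\<close>

definition T :: "nat set" where "T = {..<q} \<union> (\<lambda>k. k + q) ` set ks"

lemma finite_T: "finite T" by (simp add: T_def)

text \<open>Criticality enters here, in contrapositive form: subtracting \<open>q\<close> from an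
  element of \<open>ks\<close> that is at least \<open>q\<close> stays in \<open>ks\<close>.\<close>

lemma ks_subset_T: "set ks \<subseteq> T"
proof
  fix k assume k: "k \<in> set ks"
  show "k \<in> T"
  proof (cases "k < q")
    case False
    hence "k - q \<in> set ks"
      using critical_degree_shift[OF critical, of "k - q"] k by auto
    thus ?thesis using False by (force simp: T_def intro: image_eqI[of _ _ "k - q"])
  qed (simp add: T_def)
qed

text \<open>Integers below \<open>- int l\<close> all lie in \<open>part_M lam\<close>: hence
  \<open>part_G\<close> contains none of them, and every \<open>n < q\<close> belongs to
  \<open>T\<close>.\<close>

lemma part_G_eq: "part_G lam (int q) = (\<lambda>n. int n - int l) ` (T - set ks)"
proof -
  have T: "int n - int l \<in> (\<lambda>i. i + int q) ` part_M lam \<longleftrightarrow> n \<in> T" for n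
  proof -
    have "int n - int l \<in> (\<lambda>i. i + int q) ` part_M lam \<longleftrightarrow> int n - int q - int l \<in> part_M lam"
      by (auto simp: image_iff algebra_simps intro!: bexI[of _ "int n - int q - int l"])
    also have "\<dots> \<longleftrightarrow> n \<in> T"
    proof (cases "n < q")
      case True
      thus ?thesis by (auto simp: T_def intro: less_mem_part_M)
    next
      case False
      hence "int n - int q - int l = int (n - q) - int l" by simp
      hence "int n - int q - int l \<in> part_M lam \<longleftrightarrow> n - q \<in> set ks" by (simp only: mem_part_M_iff)
      also have "\<dots> \<longleftrightarrow> n \<in> T"
        using False by (auto simp: T_def image_iff intro!: bexI[of _ "n - q"])
      finally show ?thesis .
    qed
    finally show ?thesis .
  qed
  show ?thesis
  proof (rule Set.set_eqI)
    fix x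
    have "x \<in> part_G lam (int q) \<longleftrightarrow>
        (\<exists>n. x = int n - int l \<and> n \<notin> set ks \<and> int n - int l \<in> (\<lambda>i. i + int q) ` part_M lam)"
      unfolding part_G_def Int_iff mem_part_J_iff by metis
    also have "\<dots> \<longleftrightarrow> x \<in> (\<lambda>n. int n - int l) ` (T - set ks)"
      unfolding T by blast
    finally show "x \<in> part_G lam (int q) \<longleftrightarrow> x \<in> (\<lambda>n. int n - int l) ` (T - set ks)" .
  qed
qed

lemma card_T: "card T = q + card (set ks)"
proof -
  have "{..<q} \<inter> (\<lambda>k. k + q) ` set ks = {}" by auto
  thus ?thesis by (simp add: T_def card_Un_disjoint card_image inj_on_def)
qed

lemma inj_diff_l: "inj_on (\<lambda>n. int n - int l) B"
  by (auto simp: inj_on_def)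

lemma card_part_G: "card (part_G lam (int q)) = q"
  by (simp add: part_G_eq card_image[OF inj_diff_l] card_Diff_subset ks_subset_T card_T)

lemma part_gamma_eq: "part_gamma lam (int q) (int n - int l) = (\<Prod>t\<in>T - set ks. int n - int t)"
  by (simp add: part_gamma_def part_G_eq prod.reindex[OF inj_diff_l])

text \<open>Both sides are the product over \<open>T\<close>, split once as
  \<open>T - set ks\<close> and \<open>set ks\<close>, and once as in the definition of
  \<open>T\<close>.\<close>

lemma part_gamma_mult:
  assumes "n \<ge> q"
  shows "part_gamma lam (int q) (int n - int l) * (\<Prod>k\<in>set ks. int n - int k) =
    int (\<Prod>j<q. n - j) * (\<Prod>k\<in>set ks. int (n - q) - int k)"
proof -
  have "part_gamma lam (int q) (int n - int l) * (\<Prod>k\<in>set ks. int n - int k) =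
      (\<Prod>t\<in>T. int n - int t)"
    unfolding part_gamma_eq using prod.subset_diff[OF ks_subset_T finite_T] by metis
  also have "\<dots> = (\<Prod>t<q. int n - int t) * (\<Prod>t\<in>(\<lambda>k. k + q) ` set ks. int n - int t)"
    unfolding T_def by (rule prod.union_disjoint) auto
  also have "(\<Prod>t<q. int n - int t) = int (\<Prod>j<q. n - j)"
    unfolding of_nat_prod by (rule prod.cong) (use assms in auto)
  also have "(\<Prod>t\<in>(\<lambda>k. k + q) ` set ks. int n - int t) = (\<Prod>k\<in>set ks. int (n - q) - int k)"
    by (subst prod.reindex) (use assms in \<open>auto simp: inj_on_def of_nat_diff algebra_simps intro!: prod.cong\<close>)
  finally show ?thesis .
qed

section \<open>Enumerations of \<open>part_G\<close> and the Wronskian of the corresponding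
  \<open>R_fun\<close>\<close>

context
  fixes js assumes distinct_js: "distinct js" and set_js: "set js = part_G lam (int q)"
begin

definition ns where "ns = map (\<lambda>j. nat (j + int l)) js"

lemma js_eq: "js = map (\<lambda>n. int n - int l) ns"
proof -
  have "map (\<lambda>n. int n - int l) ns = map (\<lambda>j. j) js"
    unfolding ns_def map_map by (rule map_cong) (auto simp: set_js part_G_eq)
  thus ?thesis by simp
qed

lemma set_ns: "set ns = T - set ks"
  by (force simp: ns_def set_js part_G_eq image_image)

lemma distinct_ns: "distinct ns"
  using distinct_js by (subst (asm) js_eq) (simp add: distinct_map)

lemma length_js: "length js = q"
  using distinct_card[OF distinct_js] by (simp add: set_js card_part_G)

lemma distinct_ks_ns: "distinct (ks @ ns)"
  by (auto simp: distinct_ks distinct_ns set_ns)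

lemma wronskian_A_hermite: "wronskian dx (map (diffop_apply id dx A) (map hermite ns)) \<noteq> 0"
  using wronskian_hermite_nonzero[OF distinct_ks_ns]
    wronskian_dx_append[OF wronskian_hermite_list, of "map hermite ns"]
  by (auto simp: A_def hermite_list_eq)

lemma map_R_fun: "map (R_fun lam) js = map (\<lambda>n. R_coeff n * diffop_apply id dx A (hermite n)) ns"
  by (subst js_eq) (simp add: R_fun_eq)

lemma wronskian_R_fun: "wronskian dx (map (R_fun lam) js) \<noteq> 0"
proof -
  have "R_coeff n \<noteq> 0" if "n \<in> set ns" for n
    using that by (auto simp: R_coeff_def set_ns simp del: of_int_prod)
  thus ?thesis
    using wronskian_A_hermite
    unfolding map_R_fun by (subst wronskian_const_mult) (auto simp: dx_R_coeff prod_list_zero_iff o_def)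
qed

text \<open>The two lists differ only by factors constant in \<open>x\<close>, so the operator of
  one annihilates the other.\<close>

lemma wronski_op_R_fun:
  "wronski_op (map (R_fun lam) js) = wronski_op (map (diffop_apply id dx A) (map hermite ns))"
proof (rule eq_wronski_opI[symmetric])
  fix f assume "f \<in> set (map (R_fun lam) js)"
  then obtain n where n: "n \<in> set ns" "f = R_coeff n * diffop_apply id dx A (hermite n)"
    by (auto simp: map_R_fun)
  thus "diffop_apply id dx (wronski_op (map (diffop_apply id dx A) (map hermite ns))) f = 0"
    using ratfun.diffop_apply_const_mult[OF dx_R_coeff[of n]] wronski_op_annihilates[OF wronskian_A_hermite]
    by simp
qed (use monic_wronski_op[OF wronskian_A_hermite] wronskian_R_fun in \<open>auto simp: map_R_fun\<close>)

end

end

section \<open>The intertwining relation, for rational functions and Laurent series at once\<close>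

locale critical_embedding = critical + diff_embedding_idom h D for h :: "ratfun \<Rightarrow> 'a::idom" and D
begin

text \<open>Both sides are the operator of the Hermite polynomials indexed by \<open>T\<close>: the
  left one splits off \<open>ks\<close> first, the right one \<open>{..<q}\<close>.\<close>

lemma wronski_op_R_fun_A:
  assumes "distinct js" and "set js = part_G lam (int q)"
  shows "diffop_apply h D (wronski_op (map (R_fun lam) js)) (diffop_apply h D A F) =
    diffop_apply h D A ((D ^^ q) F)"
proof -
  define ns' where "ns' = [0..<q] @ map (\<lambda>k. k + q) ks"
  have "distinct ns'" "set ns' = T"
    using distinct_ks by (auto simp: ns'_def T_def distinct_map inj_on_def)
  hence eq: "wronski_op (map hermite (ks @ ns js)) = wronski_op (map hermite ns')"
    using distinct_ks_ns[OF assms] set_ns[OF assms] ks_subset_T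
    by (intro wronski_op_hermite_cong) auto
  have "diffop_apply h D (wronski_op (map (R_fun lam) js)) (diffop_apply h D A F) =
      diffop_apply h D (wronski_op (map hermite ks @ map hermite (ns js))) F"
    unfolding wronski_op_R_fun[OF assms] A_def hermite_list_eq
    using wronskian_hermite_nonzero[OF distinct_ks_ns[OF assms]]
      wronskian_hermite_nonzero[OF distinct_ks]
    by (intro wronski_op_append[symmetric]) auto
  also have "\<dots> = diffop_apply h D A ((D ^^ q) F)"
    using wronski_op_hermite_shift[OF distinct_ks, of q F] eq
    by (simp add: ns'_def A_def hermite_list_eq)
  finally show ?thesis .
qed

end

section \<open>Identification of \<open>L_op\<close> and the lowering relation\<close>

context critical
begin

interpretation ratfun: critical_embedding lam q id dx ..
interpretation fls: critical_embedding lam q fls_const dx_fls ..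

text \<open>Applied to the generating function, the intertwining relation shows that the Wronskian
  operator has eigenvalue \<open>z^q\<close> on \<open>Psi_fun lam\<close>;
  \<open>diffop_eqI\<close> gives uniqueness.\<close>

lemma L_op_eq:
  assumes "distinct js" and "set js = part_G lam (int q)"
  shows "L_op lam q = wronski_op (map (R_fun lam) js)"
proof -
  define e where "e = fps_to_fls hermite_gf"
  have "map_poly ratC (monom 1 q) = monom 1 q"
    by (subst map_poly_monom) (auto simp: ratC_def simp flip: one_pCons)
  hence z: "fps_to_fls (fps_of_poly (map_poly ratC (monom 1 q))) = fls_X_intpow (int q)"
    by (simp add: fps_of_poly_monom' fps_to_fls_power fls_X_power_conv_shift_1)
  have "diffop_apply fls_const dx_fls (wronski_op (map (R_fun lam) js)) (Psi_fun lam) =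
      fls_X_intpow (- int l) * diffop_apply fls_const dx_fls A (fls_X_intpow (int q) * e)"
    by (simp only: Psi_fun_eq diffop_apply_fls_X_intpow_mult fls.wronski_op_R_fun_A[OF assms]
        dx_fls_pow_hermite_gf e_def)
  also have "\<dots> = fls_X_intpow (int q) * Psi_fun lam"
    by (simp only: Psi_fun_eq diffop_apply_fls_X_intpow_mult e_def mult.left_commute)
  finally show ?thesis
    unfolding L_op_def flat_def z by (intro the_equality diffop_eqI) auto
qed

text \<open>The intertwining relation applied to \<open>H_n\<close>. The truncated
  \<open>n - q\<close> is harmless, as the falling factorial vanishes for
  \<open>n < q\<close>.\<close>

lemma L_op_R_fun:
  "diffop_apply id dx (L_op lam q) (R_fun lam (int n - int l)) =
    of_nat (\<Prod>j<q. n - j) / of_int (\<Prod>k\<in>set ks. int n - int k) *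
      diffop_apply id dx A (hermite (n - q))"
proof -
  have "finite (part_G lam (int q))" by (simp add: part_G_eq finite_T)
  then obtain js where js: "distinct js" "set js = part_G lam (int q)"
    using finite_distinct_list by metis
  have "diffop_apply id dx (L_op lam q) (R_fun lam (int n - int l)) =
      R_coeff n * diffop_apply id dx A ((dx ^^ q) (hermite n))"
    unfolding R_fun_eq L_op_eq[OF js]
    using ratfun.diffop_apply_const_mult[OF dx_R_coeff] ratfun.wronski_op_R_fun_A[OF js] by simp
  also have "diffop_apply id dx A ((dx ^^ q) (hermite n)) =
      of_nat (\<Prod>j<q. n - j) * diffop_apply id dx A (hermite (n - q))"
    using ratfun.diffop_apply_const_mult[OF dx_of_nat] by (simp add: dx_pow_hermite del: of_nat_prod)
  finally show ?thesis by (simp only: R_coeff_def of_int_1 times_divide_eq_left mult_1_left)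
qed

lemma L_op_R_fun_mem:
  assumes "m \<in> part_J lam" "m - int q \<in> part_J lam"
  shows "diffop_apply id dx (L_op lam q) (R_fun lam m) =
    of_int (part_gamma lam (int q) m) * R_fun lam (m - int q)"
proof -
  obtain n n' where n: "m = int n - int l" "n \<notin> set ks"
    and n': "m - int q = int n' - int l" "n' \<notin> set ks"
    using assms by (auto simp: mem_part_J_iff)
  hence "n' = n - q" "n \<ge> q" by auto
  define P where "P n = (\<Prod>k\<in>set ks. int n - int k)" for n
  have "P n \<noteq> 0" "P n' \<noteq> 0" using n n' by (auto simp: P_def)
  hence nz: "of_int (P n) \<noteq> (0 :: ratfun)" "of_int (P n') \<noteq> (0 :: ratfun)" by simp_all
  have "part_gamma lam (int q) m * P n = int (\<Prod>j<q. n - j) * P n'"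
    using part_gamma_mult[OF \<open>n \<ge> q\<close>] by (simp only: P_def n \<open>n' = n - q\<close>)
  hence "of_int (part_gamma lam (int q) m * P n) = (of_int (int (\<Prod>j<q. n - j) * P n') :: ratfun)"
    by (simp only:)
  hence *: "of_int (part_gamma lam (int q) m) * of_int (P n) = (of_nat (\<Prod>j<q. n - j) * of_int (P n') :: ratfun)"
    by (simp only: of_int_mult of_int_of_nat_eq)
  \<comment> \<open>The constant in \<open>L_op_R_fun\<close> equals \<open>part_gamma\<close> times
    the normalising factor of \<open>R_fun lam (m - int q)\<close>.\<close>
  have "of_nat (\<Prod>j<q. n - j) / of_int (P n) = (of_int (part_gamma lam (int q) m) / of_int (P n') :: ratfun)"
    using * nz by (simp add: frac_eq_eq del: of_nat_prod)
  thus ?thesis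
    unfolding n'(1) R_fun_eq unfolding n(1) L_op_R_fun
    by (simp add: R_coeff_def P_def n(1) \<open>n' = n - q\<close> del: of_nat_prod of_int_prod)
qed

text \<open>Either \<open>n < q\<close> and the falling factorial is 0, or \<open>n - q\<close> lies
  in \<open>ks\<close> and \<open>A\<close> kills its Hermite polynomial. Both put \<open>n\<close>
  into \<open>T - set ks\<close>, which gives \<open>part_gamma\<close> a zero factor.\<close>

lemma L_op_R_fun_not_mem:
  assumes "m \<in> part_J lam" "m - int q \<notin> part_J lam"
  shows "diffop_apply id dx (L_op lam q) (R_fun lam m) = 0" "part_gamma lam (int q) m = 0"
proof -
  obtain n where n: "m = int n - int l" "n \<notin> set ks"
    using assms by (auto simp: mem_part_J_iff)
  have cases: "n < q \<or> n \<ge> q \<and> n - q \<in> set ks"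
    using assms(2) n by (auto simp: mem_part_J_iff)
  have "n \<in> T" using cases by (force simp: T_def intro: image_eqI[of _ _ "n - q"])
  thus "part_gamma lam (int q) m = 0"
    using n finite_T by (auto simp: part_gamma_eq)
  show "diffop_apply id dx (L_op lam q) (R_fun lam m) = 0"
    unfolding n(1) L_op_R_fun using cases A_hermite_ks by (auto intro!: bexI[of _ n])
qed

end

theorem theorem6p1:
  fixes lam :: "nat \<Rightarrow> nat" and q :: nat
  assumes "is_partition lam"
    and "q \<ge> 1"
    and "critical_degree lam q"
  shows "degree (L_op lam q) = q \<and> lead_coeff (L_op lam q) = 1 \<and>
    (\<forall>m\<in>part_J lam.
       (m - int q \<in> part_J lam \<longrightarrow>
          diffop_apply id dx (L_op lam q) (R_fun lam m) =
            of_int (part_gamma lam (int q) m) * R_fun lam (m - int q)) \<and>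
       (m - int q \<notin> part_J lam \<longrightarrow>
          diffop_apply id dx (L_op lam q) (R_fun lam m) = 0 \<and> part_gamma lam (int q) m = 0)) \<and>
    (\<forall>js. distinct js \<and> set js = part_G lam (int q) \<longrightarrow>
       length js = q \<and> wronskian dx (map (R_fun lam) js) \<noteq> 0 \<and>
       (\<forall>f. diffop_apply id dx (L_op lam q) f =
              wronskian dx (map (R_fun lam) js @ [f]) / wronskian dx (map (R_fun lam) js)) \<and>
       (\<forall>(h :: ratfun \<Rightarrow> 'a::comm_ring_1) D f. diff_extension h D \<longrightarrow>
          diffop_apply h D (L_op lam q) f =
              h (1 / wronskian dx (map (R_fun lam) js)) *
              wronskian D (map h (map (R_fun lam) js) @ [f])))"
proof -
  interpret critical lam q
    by unfold_locales (use assms in auto)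
  \<comment> \<open>Some enumeration is fixed to read off order and leading coefficient; the later
    claims treat an arbitrary one.\<close>
  have "finite (part_G lam (int q))" by (simp add: part_G_eq finite_T)
  then obtain js where js: "distinct js" "set js = part_G lam (int q)"
    using finite_distinct_list by metis
  have "degree (L_op lam q) = q \<and> lead_coeff (L_op lam q) = 1"
    using monic_wronski_op[OF wronskian_R_fun[OF js]] length_js[OF js] by (simp add: L_op_eq[OF js])
  \<comment> \<open>The target is an arbitrary commutative ring, so the plain
    \<open>diff_embedding\<close> is instantiated.\<close>
  moreover have "diffop_apply h D (L_op lam q) f =
      h (1 / wronskian dx (map (R_fun lam) js)) * wronskian D (map h (map (R_fun lam) js) @ [f])"
    if js: "distinct js" "set js = part_G lam (int q)" and "diff_extension h D"
    for h :: "ratfun \<Rightarrow> 'a" and D f js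
    unfolding L_op_eq[OF js]
    by (intro diff_embedding.diffop_apply_wronski_op diff_embedding_if_diff_extension
        wronskian_R_fun js that)
  moreover have "diffop_apply id dx (L_op lam q) f =
      wronskian dx (map (R_fun lam) js @ [f]) / wronskian dx (map (R_fun lam) js)"
    if "distinct js" "set js = part_G lam (int q)" for f js
    unfolding L_op_eq[OF that] by (intro diffop_apply_dx_wronski_op wronskian_R_fun that)
  ultimately show ?thesis
    using L_op_R_fun_mem L_op_R_fun_not_mem length_js wronskian_R_fun by blast
qed

end
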